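(* Let $\gamma\in(0,1]$, $p\in(1,\infty)$ and $w\in A_p$. Then for any $f\in L_p(w)$ we have $$\|f\|_{L_p(w)}\le N\|f^{\#}_{\gamma}\|_{L_p(w)},$$ where the constant $N$ depends only on $p$, $N_0$, $\gamma$, and $[w]_{A_p}$.
   Context: Fix integers $d\ge1$ and $k_1,\dots,k_d\ge 1$. Let $\Omega=I_1\times\dots\times I_d\subset\mathbb{R}^d$, where each $I_j$ is either $\mathbb{R}$ or a half-line $[a_j,\infty)$. For $n\in\mathbb{Z}$ let $\mathbb{C}_n$ be the family of those "dyadic cubes" $$[i_12^{-k_1n},(i_1+1)2^{-k_1n})\times\dots\times[i_d2^{-k_dn},(i_d+1)2^{-k_dn}),\qquad i_1,\dots,i_d\in\mathbb{Z},$$ which are contained in $\Omega$, and $\mathbb{C}=\bigcup_{n\in\mathbb{Z}}\mathbb{C}_n$. It is assumed that for each $n\in\mathbb{Z}$ every $x\in\Omega$ belongs to a (unique) element of $\mathbb{C}_n$. For $x\in\Omega$, $l>0$ put $$C_{l,x}=x+[0,l^{k_1})\times\dots\times[0,l^{k_d}),\qquad C_l(x)=x+(-l^{k_1}/2,l^{k_1}/2)\times\dots\times(-l^{k_d}/2,l^{k_d}/2).$$ Let $\mathbb{Q}$ be the collection of all $C_l(x)$, $x\in\Omega$, $l>0$, that lie entirely in $\Omega$. $\mu$ is a measure on the Borel subsets of $\Omega$, finite on every $C_{l,x}$, such that: (1) $\lim_{l\to\infty}\mu(C_{l,x})=\infty$ for every $x\in\Omega$; (2) $\mu(\partial\Omega)=0$;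 (3) $\mu(C_{4l}(x)\cap\Omega)\le N_0\,\mu(C_l(x))$ for every $C_l(x)\in\mathbb{Q}$, where $N_0$ is a constant. For a Borel set $A$, $f_A=\frac1{\mu(A)}\int_A f\,\mu(dx)$, also written as an average integral. Weights: let $w$ be a measurable function on $\Omega$ with $0<w<\infty$ $\mu$-a.e. and $w_Q<\infty$ for every $Q\in\mathbb{Q}$. For $p\in(1,\infty)$, $w$ is an $A_p$-weight if there is a constant $N$ with $w_Q\big((w^{-1/(p-1)})_Q\big)^{p-1}\le N$ for all $Q\in\mathbb{Q}$; the least such $N$ is $[w]_{A_p}$. $L_p(w)=L_p(\Omega,w\,\mu(dx))$. The dyadic sharp function is $$f^{\#}_{\gamma}(x)=\sup_{C\in\mathbb{C},\,C\ni x}\Big(\frac{1}{\mu(C)^2}\int_C\int_C|f(z)-f(y)|^{\gamma}\,\mu(dz)\,\mu(dy)\Big)^{1/\gamma}.$$ *)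

theory Defs
  imports "HOL-Analysis.Analysis"
begin

text \<open>
  Points of $d$-dimensional space are extensional functions on \<open>{..<d}\<close>, so that \<open>d\<close> is an
  ordinary variable and a constant can be required not to depend on it.
\<close>

definition Omega :: "nat \<Rightarrow> (nat \<Rightarrow> real set) \<Rightarrow> (nat \<Rightarrow> real) set"
  where "Omega d I = PiE {..<d} I"

definition dyadic_cubes ::
    "nat \<Rightarrow> (nat \<Rightarrow> nat) \<Rightarrow> (nat \<Rightarrow> real set) \<Rightarrow> int \<Rightarrow> (nat \<Rightarrow> real) set set"
  where "dyadic_cubes d k I n =
    {C. (\<exists>i :: nat \<Rightarrow> int.
          C = PiE {..<d} (\<lambda>j. {of_int (i j) * 2 powi (- (int (k j) * n)) ..<
                                (of_int (i j) + 1) * 2 powi (- (int (k j) * n))}))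
        \<and> C \<subseteq> Omega d I}"

definition all_dyadic_cubes ::
    "nat \<Rightarrow> (nat \<Rightarrow> nat) \<Rightarrow> (nat \<Rightarrow> real set) \<Rightarrow> (nat \<Rightarrow> real) set set"
  where "all_dyadic_cubes d k I = (\<Union>n. dyadic_cubes d k I n)"

definition corner_cube ::
    "nat \<Rightarrow> (nat \<Rightarrow> nat) \<Rightarrow> real \<Rightarrow> (nat \<Rightarrow> real) \<Rightarrow> (nat \<Rightarrow> real) set"
  where "corner_cube d k l x = PiE {..<d} (\<lambda>j. {x j ..< x j + l ^ k j})"

definition centered_cube ::
    "nat \<Rightarrow> (nat \<Rightarrow> nat) \<Rightarrow> real \<Rightarrow> (nat \<Rightarrow> real) \<Rightarrow> (nat \<Rightarrow> real) set"
  where "centered_cube d k l x = PiE {..<d} (\<lambda>j. {x j - l ^ k j / 2 <..< x j + l ^ k j / 2})"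

definition inner_cubes ::
    "nat \<Rightarrow> (nat \<Rightarrow> nat) \<Rightarrow> (nat \<Rightarrow> real set) \<Rightarrow> (nat \<Rightarrow> real) set set"
  where "inner_cubes d k I =
    {centered_cube d k l x |l x. 0 < l \<and> x \<in> Omega d I \<and> centered_cube d k l x \<subseteq> Omega d I}"

locale dyadic_setting =
  fixes d :: nat
    and k :: "nat \<Rightarrow> nat"
    and I :: "nat \<Rightarrow> real set"
    and M :: "(nat \<Rightarrow> real) measure"
    and N0 :: real
  assumes dim_pos: "1 \<le> d"
    and exponents_pos: "\<And>j. j < d \<Longrightarrow> 1 \<le> k j"
    and intervals: "\<And>j. j < d \<Longrightarrow> I j = UNIV \<or> (\<exists>a. I j = {a..})"
    and dyadic_partition: "\<And>n x. x \<in> Omega d I \<Longrightarrow> \<exists>!C. C \<in> dyadic_cubes d k I n \<and> x \<in> C"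
    and sets_M: "sets M = sets (restrict_space (PiM {..<d} (\<lambda>_. borel)) (Omega d I))"
    and finite_corner: "\<And>x l. x \<in> Omega d I \<Longrightarrow> 0 < l \<Longrightarrow> emeasure M (corner_cube d k l x) < \<infinity>"
    and corner_unbounded:
      "\<And>x. x \<in> Omega d I \<Longrightarrow> ((\<lambda>l. emeasure M (corner_cube d k l x)) \<longlongrightarrow> \<infinity>) at_top"
    and boundary_null:
      "emeasure M (product_topology (\<lambda>_. euclidean) {..<d} frontier_of Omega d I) = 0"
    and doubling:
      "\<And>x l. x \<in> Omega d I \<Longrightarrow> 0 < l \<Longrightarrow> centered_cube d k l x \<subseteq> Omega d I \<Longrightarrow>
        emeasure M (centered_cube d k (4 * l) x \<inter> Omega d I)
          \<le> ennreal N0 * emeasure M (centered_cube d k l x)"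

text \<open>Powers of extended nonnegative numbers, used for positive exponents only.\<close>

definition epow :: "ennreal \<Rightarrow> real \<Rightarrow> ennreal"
  where "epow x a = (if x = \<infinity> then \<infinity> else ennreal (enn2real x powr a))"

definition avg :: "'a measure \<Rightarrow> 'a set \<Rightarrow> ('a \<Rightarrow> ennreal) \<Rightarrow> ennreal"
  where "avg M A g = (\<integral>\<^sup>+x\<in>A. g x \<partial>M) / emeasure M A"

definition weight ::
    "nat \<Rightarrow> (nat \<Rightarrow> nat) \<Rightarrow> (nat \<Rightarrow> real set) \<Rightarrow> (nat \<Rightarrow> real) measure \<Rightarrow>
      ((nat \<Rightarrow> real) \<Rightarrow> ennreal) \<Rightarrow> bool"
  where "weight d k I M w \<longleftrightarrow>
    w \<in> borel_measurable M \<and> (AE x in M. 0 < w x \<and> w x < \<infinity>) \<and>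
    (\<forall>Q \<in> inner_cubes d k I. avg M Q w < \<infinity>)"

text \<open>The function $w^{-1/(p-1)}$ is written as the power $1/(p-1)$ of \<open>inverse w\<close>.\<close>

definition Ap_bound ::
    "nat \<Rightarrow> (nat \<Rightarrow> nat) \<Rightarrow> (nat \<Rightarrow> real set) \<Rightarrow> (nat \<Rightarrow> real) measure \<Rightarrow> real \<Rightarrow>
      ((nat \<Rightarrow> real) \<Rightarrow> ennreal) \<Rightarrow> ennreal \<Rightarrow> bool"
  where "Ap_bound d k I M p w N \<longleftrightarrow>
    (\<forall>Q \<in> inner_cubes d k I.
      avg M Q w * epow (avg M Q (\<lambda>x. epow (inverse (w x)) (1 / (p - 1)))) (p - 1) \<le> N)"

definition Ap_weight ::
    "nat \<Rightarrow> (nat \<Rightarrow> nat) \<Rightarrow> (nat \<Rightarrow> real set) \<Rightarrow> (nat \<Rightarrow> real) measure \<Rightarrow> real \<Rightarrow>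
      ((nat \<Rightarrow> real) \<Rightarrow> ennreal) \<Rightarrow> bool"
  where "Ap_weight d k I M p w \<longleftrightarrow>
    weight d k I M w \<and> (\<exists>N < \<infinity>. Ap_bound d k I M p w N)"

definition Ap_const ::
    "nat \<Rightarrow> (nat \<Rightarrow> nat) \<Rightarrow> (nat \<Rightarrow> real set) \<Rightarrow> (nat \<Rightarrow> real) measure \<Rightarrow> real \<Rightarrow>
      ((nat \<Rightarrow> real) \<Rightarrow> ennreal) \<Rightarrow> ennreal"
  where "Ap_const d k I M p w = (LEAST N. Ap_bound d k I M p w N)"

text \<open>
  The space $L_p(w)$ consists of functions on the measure space \<open>density M w\<close>. The norm is
  defined for \<open>ennreal\<close>-valued functions because the sharp function may be infinite.
\<close>

definition Lp_norm :: "real \<Rightarrow> 'a measure \<Rightarrow> ('a \<Rightarrow> ennreal) \<Rightarrow> ennreal"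
  where "Lp_norm p \<nu> g = epow (\<integral>\<^sup>+x. epow (g x) p \<partial>\<nu>) (1 / p)"

definition Lp_space :: "real \<Rightarrow> 'a measure \<Rightarrow> ('a \<Rightarrow> real) set"
  where "Lp_space p \<nu> = {f \<in> borel_measurable \<nu>. Lp_norm p \<nu> (\<lambda>x. ennreal \<bar>f x\<bar>) < \<infinity>}"

definition dyadic_sharp ::
    "nat \<Rightarrow> (nat \<Rightarrow> nat) \<Rightarrow> (nat \<Rightarrow> real set) \<Rightarrow> (nat \<Rightarrow> real) measure \<Rightarrow> real \<Rightarrow>
      ((nat \<Rightarrow> real) \<Rightarrow> real) \<Rightarrow> (nat \<Rightarrow> real) \<Rightarrow> ennreal"
  where "dyadic_sharp d k I M \<gamma> f x =
    (SUP C \<in> {C \<in> all_dyadic_cubes d k I. x \<in> C}.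
      epow ((\<integral>\<^sup>+y\<in>C. (\<integral>\<^sup>+z\<in>C. ennreal (\<bar>f z - f y\<bar> powr \<gamma>) \<partial>M) \<partial>M) / (emeasure M C)\<^sup>2)
           (1 / \<gamma>))"

end

theory Submission
  imports Defs
begin

text \<open>
  Since $\gamma \le 1$, the function $g = |f|^\gamma$ satisfies
  $g(z) \le |f(y) - f(z)|^\gamma + g(y)$, and it suffices to bound $g$ in $L_r(w)$, $r = p / \gamma$.
  Let \<open>L(t)\<close> be the union of the dyadic cubes with average of $g$ above \<open>t\<close>. Averaging the inequality
  over the parent of a maximal cube of \<open>L(t)\<close> gives, for \<open>b\<close> close to 1 and small \<open>c\<close>,
  \[ w(L(bt)) \le \delta\, w(L(t)) + w\{h > ct\}, \qquad h = (f^\#_\gamma)^\gamma , \]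
  where $\delta < 1$ is the constant for which the $A_p$ condition yields $w(E) \le \delta w(C)$ whenever
  $E \subseteq C$ and $\mu(E) \le \mu(C) / 2$. As \<open>b\<close> may be taken so close to 1 that
  $b^r \delta < 1$, no power of the ratio $\mu(E) / \mu(C)$ (no reverse Hoelder inequality) is
  needed. The sequence $b^{rj} w(L(b^j))$, $j \in \mathbb{Z}$, is bounded by the weak type inequality
  and hence, being contracted up to a summable error, it is summable; summing over \<open>j\<close> proves the
  theorem, without the boundedness of the maximal operator on $L_r(w)$.
\<close>

subsection \<open>Powers and Jensen's inequality\<close>

text \<open>Two obstacles shape the argument. Maximal cubes exist only if the averages of
  \<open>g\<close> over growing ancestors drop below \<open>t\<close>, and all that is known of
  \<open>g\<close> is that it lies in L_r(w). The weight supplies what is missing: a cube with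
  average at least \<open>t\<close> has weight bounded in terms of the norm of \<open>g\<close>,
  whereas the weights of the ancestors are unbounded, because each doubling of \<mu> multiplies the
  weight by at least 1 / \<delta>. The second obstacle is that the A_p condition speaks of open
  cubes inside \<Omega>, while dyadic cubes are half-open and may touch the boundary; the null
  boundary and the doubling condition carry it over. Moreover g is measured with the exponent r = p
  / \<gamma>, so A_p has to be raised to A_r by Jensen's inequality. The good-lambda argument itself
  rests on nesting, on doubling between parent and child and on an integrated form of A_r. It is
  carried out for an abstract lattice, which keeps the dimension and the exponents k_j out of the
  constant.\<close>

lemma epow_ennreal: "0 \<le> x \<Longrightarrow> epow (ennreal x) a = ennreal (x powr a)"
  by (simp add: epow_def)

lemma epow_zero [simp]: "epow 0 a = 0"
  by (simp add: epow_def)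

lemma epow_top [simp]: "epow top a = top"
  by (simp add: epow_def)

lemma epow_eq_top_iff [simp]: "epow x a = top \<longleftrightarrow> x = top"
  by (simp add: epow_def)

lemma epow_less_top_iff [simp]: "epow x a < top \<longleftrightarrow> x < top"
  by (cases x) (auto simp: epow_ennreal)

lemma epow_eq_zero_iff [simp]: "epow x a = 0 \<longleftrightarrow> x = 0"
  by (cases x) (auto simp: epow_ennreal)

lemma epow_mono: "x \<le> y \<Longrightarrow> 0 \<le> a \<Longrightarrow> epow x a \<le> epow y a"
  by (cases x; cases y) (auto simp: epow_ennreal top_unique intro!: ennreal_leI powr_mono2)

lemma epow_epow: "epow (epow x a) b = epow x (a * b)"
  by (cases x) (auto simp: epow_ennreal powr_powr)

lemma epow_one [simp]: "epow x 1 = x"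
  by (cases x) (auto simp: epow_ennreal)

lemma epow_mult: "epow (x * y) a = epow x a * epow y a"
proof (cases "x = 0 \<or> y = 0 \<or> x = top \<or> y = top")
  case True
  then show ?thesis by (auto simp: ennreal_mult_top ennreal_top_mult)
next
  case False
  then show ?thesis
    by (cases x; cases y) (auto simp: epow_ennreal powr_mult ennreal_mult[symmetric])
qed

lemma epow_add: "epow x (a + b) = epow x a * epow x b"
proof (cases x)
  case (real r)
  then show ?thesis by (simp add: epow_ennreal powr_add ennreal_mult)
qed (simp add: ennreal_mult_top)

lemma borel_measurable_epow [measurable]:
  assumes [measurable]: "f \<in> borel_measurable M"
  shows "(\<lambda>x. epow (f x) a) \<in> borel_measurable M"
  unfolding epow_def by measurable

text \<open>The tangent of $t \mapsto t^p$ at $a$, with both sides moved so that no subtraction occurs.\<close>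

lemma epow_tangent:
  fixes a p :: real
  assumes "1 < p" "0 \<le> a"
  shows "ennreal (p * a powr (p - 1)) * t \<le> epow t p + ennreal ((p - 1) * a powr p)"
proof (cases t)
  case (real s)
  have "s * a powr (p - 1) \<le> s powr p / p + (a powr (p - 1)) powr (p / (p - 1)) / (p / (p - 1))"
    using assms real by (intro Youngs_inequality) (auto simp: field_simps)
  moreover have "(p - 1) * (p / (p - 1)) = p"
    using assms by simp
  then have "(a powr (p - 1)) powr (p / (p - 1)) = a powr p"
    unfolding powr_powr by simp
  ultimately have "p * (s * a powr (p - 1)) \<le> p * (s powr p / p + a powr p * (p - 1) / p)"
    using assms by (intro mult_left_mono) auto
  moreover have "p * (s powr p / p + a powr p * (p - 1) / p) = s powr p + (p - 1) * a powr p"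
    using assms by (simp add: distrib_left)
  ultimately have "p * a powr (p - 1) * s \<le> s powr p + (p - 1) * a powr p"
    by (simp add: mult_ac)
  then show ?thesis using assms real
    by (auto simp: epow_ennreal ennreal_mult'[symmetric] ennreal_plus[symmetric] simp del: ennreal_plus
        intro!: ennreal_leI)
qed simp

text \<open>Integrating the tangent inequality at \<open>a\<close> and then choosing
  \<open>a\<close> as the mean of \<open>h\<close> gives Jensen's inequality without normalising the
  measure. The tangent at 1 shows beforehand that this mean is finite.\<close>

lemma nn_integral_Jensen:
  assumes [measurable]: "h \<in> borel_measurable N" and p: "1 \<le> p"
    and fin: "emeasure N (space N) < \<infinity>"
  shows "epow (\<integral>\<^sup>+x. h x \<partial>N) p \<le> epow (emeasure N (space N)) (p - 1) * (\<integral>\<^sup>+x. epow (h x) p \<partial>N)"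
proof (cases "p = 1 \<or> (\<integral>\<^sup>+x. h x \<partial>N) = 0")
  case True
  then consider "p = 1" | "(\<integral>\<^sup>+x. h x \<partial>N) = 0" by blast
  then show ?thesis
  proof cases
    case 1
    show ?thesis
    \<comment> \<open>For \<open>p = 1\<close> the first factor on the right has exponent 0, and
      \<open>epow 0 0\<close> is 0, not 1. The null measure is therefore split off.\<close>
    proof (cases "emeasure N (space N) = 0")
      case True
      then have "(\<integral>\<^sup>+x. h x \<partial>N) = (\<integral>\<^sup>+x. 0 \<partial>N)"
        by (intro nn_integral_cong_AE AE_I[where N="space N"]) auto
      then show ?thesis using 1 by simp
    next
      case False
      obtain m where m: "emeasure N (space N) = ennreal m" "0 \<le> m" using fin by (cases "emeasure N (space N)") auto
      with False have "epow (emeasure N (space N)) 0 = 1" by (auto simp: epow_ennreal)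
      then show ?thesis using 1 by simp
    qed
  qed simp
next
  case False
  then have p1: "1 < p" and h0: "(\<integral>\<^sup>+x. h x \<partial>N) \<noteq> 0" using p by auto
  have "emeasure N (space N) \<noteq> 0"
  proof
    assume "emeasure N (space N) = 0"
    then have "(\<integral>\<^sup>+x. h x \<partial>N) = (\<integral>\<^sup>+x. 0 \<partial>N)"
      by (intro nn_integral_cong_AE AE_I[where N="space N"]) auto
    with h0 show False by simp
  qed
  then obtain m where m: "emeasure N (space N) = ennreal m" "0 < m"
    using fin by (cases "emeasure N (space N)") (auto simp: less_le)
  have tangent: "ennreal (p * a powr (p - 1)) * (\<integral>\<^sup>+x. h x \<partial>N)
      \<le> (\<integral>\<^sup>+x. epow (h x) p \<partial>N) + ennreal ((p - 1) * a powr p * m)" if "0 \<le> a" for a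
  proof -
    have "ennreal (p * a powr (p - 1)) * (\<integral>\<^sup>+x. h x \<partial>N)
        = (\<integral>\<^sup>+x. ennreal (p * a powr (p - 1)) * h x \<partial>N)"
      by (simp add: nn_integral_cmult)
    also have "\<dots> \<le> (\<integral>\<^sup>+x. epow (h x) p + ennreal ((p - 1) * a powr p) \<partial>N)"
      by (intro nn_integral_mono epow_tangent p1 that)
    also have "\<dots> = (\<integral>\<^sup>+x. epow (h x) p \<partial>N) + ennreal ((p - 1) * a powr p * m)"
      using m p1 by (simp add: nn_integral_add ennreal_mult)
    finally show ?thesis .
  qed
  show ?thesis
  proof (cases "(\<integral>\<^sup>+x. epow (h x) p \<partial>N) = top")
    case True
    then show ?thesis using m by (simp add: epow_ennreal ennreal_mult_top)
  next
    case False
    then obtain J where J: "(\<integral>\<^sup>+x. epow (h x) p \<partial>N) = ennreal J" "0 \<le> J"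
      by (cases "\<integral>\<^sup>+x. epow (h x) p \<partial>N") auto
    have "(\<integral>\<^sup>+x. h x \<partial>N) \<noteq> top"
    proof
      assume "(\<integral>\<^sup>+x. h x \<partial>N) = top"
      then show False using tangent[of 1] J p1 m
        by (auto simp: ennreal_mult_top top_unique)
    qed
    then obtain i where i: "(\<integral>\<^sup>+x. h x \<partial>N) = ennreal i" "0 < i"
      using h0 by (cases "\<integral>\<^sup>+x. h x \<partial>N") (auto simp: less_le)
    define a where "a = i / m"
    have a: "0 < a" "i = a * m" using i m by (auto simp: a_def)
    have "p * a powr (p - 1) * i \<le> J + (p - 1) * a powr p * m"
      using tangent[of a] a i J p1 m
      by (simp add: ennreal_mult[symmetric] ennreal_plus[symmetric] del: ennreal_plus)
    moreover have "p * a powr (p - 1) * i = p * (a powr p * m)"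
      using a by (simp add: powr_diff)
    ultimately have "p * (a powr p * m) \<le> J + (p - 1) * a powr p * m" by simp
    then have "a powr p * m \<le> J" by (simp add: algebra_simps)
    then have "m powr (p - 1) * (a powr p * m) \<le> m powr (p - 1) * J"
      using m by (intro mult_left_mono) auto
    moreover have "m powr (p - 1) * (a powr p * m) = i powr p"
      using a m by (simp add: powr_mult powr_diff)
    ultimately show ?thesis using i m J
      by (auto simp: epow_ennreal ennreal_mult'[symmetric] intro!: ennreal_leI)
  qed
qed

section \<open>Disjoint unions, geometric sums and contracting sequences\<close>

text \<open>With a density in place of \<open>N\<close>, estimates on single cubes become an
  estimate of an integral over their union.\<close>

lemma emeasure_disjoint_Union_le:
  assumes S: "countable S" "disjoint S" "S \<subseteq> sets M" and sets: "sets N = sets M"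
    and le: "\<And>C. C \<in> S \<Longrightarrow> emeasure M C \<le> c * emeasure N C"
  shows "emeasure M (\<Union>S) \<le> c * emeasure N (\<Union>S)"
proof -
  have disj: "disjoint_family_on (\<lambda>C. C) S"
    using S(2) by (auto simp: disjoint_family_on_def disjoint_def)
  have "emeasure M (\<Union>S) = (\<integral>\<^sup>+C. emeasure M C \<partial>count_space S)"
    using emeasure_UN_countable[of S "\<lambda>C. C" M] S disj by auto
  also have "\<dots> \<le> (\<integral>\<^sup>+C. c * emeasure N C \<partial>count_space S)"
    by (intro nn_integral_mono) (auto intro: le)
  also have "\<dots> = c * emeasure N (\<Union>S)"
    using emeasure_UN_countable[of S "\<lambda>C. C" N] S disj sets by (simp add: nn_integral_cmult subset_iff)
  finally show ?thesis .
qed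

text \<open>The right side is the full geometric series descending from the largest exponent.
  Removing the maximum \<open>b\<close> leaves exponents at most \<open>b - 1\<close>, since they
  are integers.\<close>

lemma sum_powr_le:
  fixes J :: "int set"
  assumes "finite J" "1 < \<beta>" "J \<noteq> {}"
  shows "(\<Sum>j\<in>J. \<beta> powr real_of_int j) \<le> \<beta> powr real_of_int (Max J) * (\<beta> / (\<beta> - 1))"
  using assms(1,3)
proof (induction J rule: finite_linorder_max_induct)
  case (insert b A)
  have Mb: "Max (insert b A) = b"
    using insert.hyps by (intro Max_eqI) auto
  have "(\<Sum>j\<in>A. \<beta> powr real_of_int j) \<le> \<beta> powr (real_of_int b - 1) * (\<beta> / (\<beta> - 1))"
  proof (cases "A = {}")
    case False
    have "Max A < b" using insert.hyps False by auto
    then have "\<beta> powr real_of_int (Max A) \<le> \<beta> powr (real_of_int b - 1)"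
      using assms(2) by (intro powr_mono) auto
    then show ?thesis
      using insert.IH[OF False] assms(2)
      by (meson divide_nonneg_nonneg less_eq_real_def mult_right_mono order_trans diff_ge_0_iff_ge zero_le_one)
  qed (use assms(2) in auto)
  also have "\<dots> = \<beta> powr b * (1 / (\<beta> - 1))"
    using assms(2) by (simp add: powr_diff)
  finally have "(\<Sum>j\<in>insert b A. \<beta> powr real_of_int j) \<le> \<beta> powr b + \<beta> powr b * (1 / (\<beta> - 1))"
    using insert.hyps by (subst sum.insert) auto
  also have "\<dots> = \<beta> powr b * (\<beta> / (\<beta> - 1))"
    using assms(2) by (simp add: field_simps)
  finally show ?case by (simp add: Mb)
qed simp

lemma sum_powr_less_le:
  fixes J :: "int set"
  assumes J: "finite J" and \<beta>: "1 < \<beta>" and s: "0 \<le> s"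
  shows "(\<Sum>j\<in>{j\<in>J. \<beta> powr real_of_int j < s}. \<beta> powr real_of_int j) \<le> s * (\<beta> / (\<beta> - 1))"
proof (cases "{j\<in>J. \<beta> powr real_of_int j < s} = {}")
  case True
  show ?thesis unfolding True using \<beta> s by auto
next
  case False
  let ?J = "{j\<in>J. \<beta> powr real_of_int j < s}"
  have "Max ?J \<in> ?J" using J False by (intro Max_in) auto
  then have "\<beta> powr real_of_int (Max ?J) * (\<beta> / (\<beta> - 1)) \<le> s * (\<beta> / (\<beta> - 1))"
    using \<beta> by (intro mult_right_mono) auto
  then show ?thesis using sum_powr_le[of ?J \<beta>] J False \<beta> by simp
qed

text \<open>Boundedness of \<open>S\<close> makes the iterated remainder vanish, so that \<open>S\<close> need not be summable a priori.\<close>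

lemma sum_le_of_contraction:
  fixes S T :: "int \<Rightarrow> real"
  assumes \<theta>: "0 \<le> \<theta>" "\<theta> < 1" and S: "\<And>j. S j \<le> B"
    and rec: "\<And>j. S j \<le> \<theta> * S (j - 1) + T (j - 1)"
    and T: "\<And>J. finite J \<Longrightarrow> sum T J \<le> \<tau>" and J: "finite J"
  shows "sum S J \<le> \<tau> / (1 - \<theta>)"
proof -
  have *: "sum S J \<le> real (card J) * \<theta> ^ n * B + \<tau> * (\<Sum>i<n. \<theta> ^ i)" if "finite J" for n J
    using that
  proof (induction n arbitrary: J)
    case 0
    then show ?case using sum_mono[of J S "\<lambda>_. B"] S by simp
  next
    case (Suc n)
    let ?J = "(\<lambda>j. j - 1) ` J"
    have inj: "inj_on (\<lambda>j::int. j - 1) J" by (auto simp: inj_on_def)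
    have "sum S J \<le> (\<Sum>j\<in>J. \<theta> * S (j - 1) + T (j - 1))"
      by (intro sum_mono rec)
    also have "\<dots> = \<theta> * sum S ?J + sum T ?J"
      by (simp add: sum.distrib sum_distrib_left sum.reindex[OF inj] o_def)
    also have "\<dots> \<le> \<theta> * (real (card ?J) * \<theta> ^ n * B + \<tau> * (\<Sum>i<n. \<theta> ^ i)) + \<tau>"
      using Suc \<theta> T by (intro add_mono mult_left_mono) auto
    also have "\<dots> = real (card J) * \<theta> ^ Suc n * B + \<tau> * (1 + \<theta> * (\<Sum>i<n. \<theta> ^ i))"
      by (simp add: card_image[OF inj] algebra_simps)
    also have "1 + \<theta> * (\<Sum>i<n. \<theta> ^ i) = (\<Sum>i<Suc n. \<theta> ^ i)"
      by (subst sum.lessThan_Suc_shift) (simp add: sum_distrib_left)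
    finally show ?case .
  qed
  have "(\<lambda>n. real (card J) * \<theta> ^ n * B + \<tau> * (\<Sum>i<n. \<theta> ^ i))
      \<longlonglongrightarrow> real (card J) * 0 * B + \<tau> * (1 / (1 - \<theta>))"
    using \<theta> geometric_sums[of \<theta>] unfolding sums_def
    by (intro tendsto_intros LIMSEQ_power_zero) auto
  then show ?thesis
    using *[OF J] by (intro LIMSEQ_le_const[where a = "sum S J"]) auto
qed

subsection \<open>Dyadic lattices\<close>

text \<open>A larger index means a finer generation, so \<open>D (n - 1)\<close> contains the
  parents of \<open>D n\<close>. \<open>D_generate\<close> takes the place of a topology: it is what
  the differentiation theorem is derived from. \<open>D_unbounded\<close> is the abstract form of
  the growth of \<mu> on large cubes.\<close>

locale dyadic_lattice =
  fixes M :: "'a measure" and D :: "int \<Rightarrow> 'a set set" and K :: real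
  assumes D_sets: "C \<in> D n \<Longrightarrow> C \<in> sets M"
    and D_countable: "countable (D n)"
    and D_cover: "x \<in> space M \<Longrightarrow> \<exists>C\<in>D n. x \<in> C"
    and D_nested: "m \<le> n \<Longrightarrow> C \<in> D m \<Longrightarrow> C' \<in> D n \<Longrightarrow> C \<inter> C' \<noteq> {} \<Longrightarrow> C' \<subseteq> C"
    and D_pos: "C \<in> D n \<Longrightarrow> 0 < emeasure M C"
    and D_finite: "C \<in> D n \<Longrightarrow> emeasure M C < \<infinity>"
    and D_parent: "C' \<in> D n \<Longrightarrow> C \<in> D (n - 1) \<Longrightarrow> C' \<subseteq> C \<Longrightarrow>
      emeasure M C \<le> ennreal K * emeasure M C'"
    and D_unbounded: "x \<in> space M \<Longrightarrow> \<exists>n. \<exists>C\<in>D n. x \<in> C \<and> ennreal B < emeasure M C"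
    and D_generate: "sets M \<subseteq> sigma_sets (space M) (\<Union>n. D n)"
    and K_pos: "0 < K"
begin

lemma D_subset_space: "C \<in> D n \<Longrightarrow> C \<subseteq> space M"
  by (rule sets.sets_into_space) (rule D_sets)

lemma D_eq: "C \<in> D n \<Longrightarrow> C' \<in> D n \<Longrightarrow> x \<in> C \<Longrightarrow> x \<in> C' \<Longrightarrow> C = C'"
  using D_nested[of n n C C'] D_nested[of n n C' C] by auto

lemma D_nonempty: "C \<in> D n \<Longrightarrow> C \<noteq> {}"
  using D_pos[of C n] by auto

lemma D_disjoint: "disjoint (D n)"
  by (rule disjointI) (metis D_eq disjoint_iff)

lemma countable_all_D: "countable (\<Union>n. D n)"
  by (intro countable_UN D_countable) auto

lemma emeasure_D_real:
  assumes "C \<in> D n"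
  shows "emeasure M C = ennreal (measure M C)" "0 < measure M C"
proof -
  show "emeasure M C = ennreal (measure M C)"
    using D_finite[OF assms] by (intro emeasure_eq_ennreal_measure) simp
  then show "0 < measure M C" using D_pos[OF assms] by simp
qed

definition cube :: "int \<Rightarrow> 'a \<Rightarrow> 'a set"
  where "cube n x = (THE C. C \<in> D n \<and> x \<in> C)"

lemma cube_eq: "C \<in> D n \<Longrightarrow> x \<in> C \<Longrightarrow> cube n x = C"
  unfolding cube_def by (rule the_equality) (simp, metis D_eq)

lemma cube_in: "x \<in> space M \<Longrightarrow> cube n x \<in> D n"
  by (metis D_cover cube_eq)

lemma in_cube: "x \<in> space M \<Longrightarrow> x \<in> cube n x"
  by (metis D_cover cube_eq)

lemma cube_antimono: "x \<in> space M \<Longrightarrow> m \<le> n \<Longrightarrow> cube n x \<subseteq> cube m x"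
  by (rule D_nested[of m n]) (auto simp: cube_in intro: in_cube)

lemma Union_D_sets: "F \<subseteq> D n \<Longrightarrow> \<Union>F \<in> sets M"
  by (intro sets.countable_Union) (auto intro: D_sets countable_subset[OF _ D_countable])

lemma Union_D_minus: "F \<subseteq> D n \<Longrightarrow> \<Union>(D n - F) = space M - \<Union>F"
proof (intro set_eqI iffI)
  fix x assume "F \<subseteq> D n" "x \<in> space M - \<Union>F"
  then show "x \<in> \<Union>(D n - F)"
    using D_cover[of x n] by auto
next
  fix x assume F: "F \<subseteq> D n" and "x \<in> \<Union>(D n - F)"
  then obtain C where C: "C \<in> D n" "C \<notin> F" "x \<in> C" by auto
  then have "x \<notin> \<Union>F" using F D_eq by blast
  then show "x \<in> space M - \<Union>F" using C D_subset_space by auto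
qed

lemma Union_D_descendants:
  assumes "C \<in> D m" "m \<le> n"
  shows "\<Union>{C' \<in> D n. C' \<subseteq> C} = C"
proof (intro set_eqI iffI)
  fix x assume x: "x \<in> C"
  then have "x \<in> space M" using D_subset_space assms by auto
  then obtain C' where C': "C' \<in> D n" "x \<in> C'" using D_cover by blast
  then have "C' \<subseteq> C" using D_nested[OF assms(2,1) C'(1)] x by blast
  with C' show "x \<in> \<Union>{C' \<in> D n. C' \<subseteq> C}" by auto
qed auto

lemma sigma_finite_measure_M: "sigma_finite_measure M"
proof
  show "\<exists>A. countable A \<and> A \<subseteq> sets M \<and> \<Union>A = space M \<and> (\<forall>a\<in>A. emeasure M a \<noteq> \<infinity>)"
  proof (intro exI conjI ballI)
    show "\<Union>(D 0) = space M"
      using D_cover D_subset_space by blast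
  qed (use D_countable D_sets D_finite in \<open>auto simp: less_top\<close>)
qed

section \<open>Approximation of measurable sets by cubes of one generation\<close>

text \<open>Cubes that meet are nested, so their intersection is one of the two; the empty set
  accounts for the others. This makes the cubes a generator for Dynkin induction.\<close>

lemma Int_stable_D: "Int_stable (insert {} (\<Union>n. D n))"
proof (rule Int_stableI)
  fix a b assume ab: "a \<in> insert {} (\<Union>n. D n)" "b \<in> insert {} (\<Union>n. D n)"
  show "a \<inter> b \<in> insert {} (\<Union>n. D n)"
  proof (cases "a \<inter> b = {}")
    case False
    then obtain m n where mn: "a \<in> D m" "b \<in> D n" using ab by blast
    then have "b \<subseteq> a \<or> a \<subseteq> b"
      using D_nested[of m n a b] D_nested[of n m b a] False by (cases "m \<le> n") (auto simp: Int_commute)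
    then have "a \<inter> b = b \<or> a \<inter> b = a" by auto
    then show ?thesis using ab by metis
  qed auto
qed

text \<open>The approximable sets form a Dynkin system that contains every cube. Approximation is
  demanded in all sufficiently fine generations, not merely in some, so that finitely many sets can
  be approximated in a common one; the disjoint union needs this. Cutting with \<open>C0\<close>
  keeps all measures finite.\<close>

lemma D_approximation:
  assumes E: "E \<in> sets M" and C0: "C0 \<in> D m" and \<epsilon>: "0 < \<epsilon>"
  shows "\<exists>N. \<forall>n\<ge>N. \<exists>F\<subseteq>D n. measure M (C0 \<inter> ((E - \<Union>F) \<union> (\<Union>F - E))) < \<epsilon>"
proof -
  have C0s: "C0 \<in> sets M" using D_sets C0 by auto
  have fm: "C0 \<inter> A \<in> fmeasurable M" if "A \<in> sets M" for A
    by (rule fmeasurableI2[of C0]) (use that C0s D_finite[OF C0] in \<open>auto simp: fmeasurable_def\<close>)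
  have sets_eq: "sets M = sigma_sets (space M) (insert {} (\<Union>n. D n))"
  proof
    show "sets M \<subseteq> sigma_sets (space M) (insert {} (\<Union>n. D n))"
      by (rule order_trans[OF D_generate]) (rule sigma_sets_mono', auto)
    show "sigma_sets (space M) (insert {} (\<Union>n. D n)) \<subseteq> sets M"
      by (rule sets.sigma_sets_subset) (auto intro: D_sets)
  qed
  have E': "E \<in> sigma_sets (space M) (insert {} (\<Union>n. D n))" using E sets_eq by simp
  have sub: "insert {} (\<Union>n. D n) \<subseteq> Pow (space M)" using D_subset_space by auto
  have "\<forall>\<epsilon>>0. \<exists>N. \<forall>n\<ge>N. \<exists>F\<subseteq>D n. measure M (C0 \<inter> ((E - \<Union>F) \<union> (\<Union>F - E))) < \<epsilon>"
    using Int_stable_D sub E'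
  proof (induction E rule: sigma_sets_induct_disjoint)
    case (basic A)
    show ?case
    proof (cases "A = {}")
      case True
      then show ?thesis by (intro allI impI exI[of _ 0] exI[of _ "{}"]) auto
    next
      case False
      then obtain k where A: "A \<in> D k" using basic by auto
      show ?thesis
      proof (intro allI impI exI[of _ k])
        fix \<epsilon> :: real and n assume "0 < \<epsilon>" "k \<le> n"
        then show "\<exists>F\<subseteq>D n. measure M (C0 \<inter> ((A - \<Union>F) \<union> (\<Union>F - A))) < \<epsilon>"
          using Union_D_descendants[OF A] by (intro exI[of _ "{C' \<in> D n. C' \<subseteq> A}"]) auto
      qed
    qed
  next
    case empty
    then show ?case by (intro allI impI exI[of _ 0] exI[of _ "{}"]) auto
  next
    case (compl A)
    show ?case
    proof (intro allI impI)
      fix \<epsilon> :: real assume "0 < \<epsilon>"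
      then obtain N where N: "\<forall>n\<ge>N. \<exists>F\<subseteq>D n. measure M (C0 \<inter> ((A - \<Union>F) \<union> (\<Union>F - A))) < \<epsilon>"
        using compl.IH by blast
      show "\<exists>N. \<forall>n\<ge>N. \<exists>F\<subseteq>D n.
          measure M (C0 \<inter> (((space M - A) - \<Union>F) \<union> (\<Union>F - (space M - A)))) < \<epsilon>"
      proof (intro exI[of _ N] allI impI)
        fix n assume "N \<le> n"
        then obtain F where F: "F \<subseteq> D n" "measure M (C0 \<inter> ((A - \<Union>F) \<union> (\<Union>F - A))) < \<epsilon>"
          using N by blast
        have "C0 \<subseteq> space M" "\<Union>F \<subseteq> space M"
          using D_subset_space[OF C0] F(1) D_subset_space by blast+
        then have "C0 \<inter> (((space M - A) - (space M - \<Union>F)) \<union> ((space M - \<Union>F) - (space M - A)))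
            = C0 \<inter> ((A - \<Union>F) \<union> (\<Union>F - A))"
          by blast
        then show "\<exists>F\<subseteq>D n.
            measure M (C0 \<inter> (((space M - A) - \<Union>F) \<union> (\<Union>F - (space M - A)))) < \<epsilon>"
          using F by (intro exI[of _ "D n - F"]) (auto simp only: Union_D_minus Diff_subset)
      qed
    qed
  next
    case (union A)
    have As: "A i \<in> sets M" for i using union.hyps(2) sets_eq by auto
    show ?case
    proof (intro allI impI)
      fix \<epsilon> :: real assume "0 < \<epsilon>"
      have "(\<lambda>k. measure M (C0 \<inter> (\<Union>i. A i) - (\<Union>i<k. A i)))
          \<longlonglongrightarrow> measure M (\<Inter>k. C0 \<inter> (\<Union>i. A i) - (\<Union>i<k. A i))"
      proof (rule Lim_measure_decseq)
        show "range (\<lambda>k. C0 \<inter> (\<Union>i. A i) - (\<Union>i<k. A i)) \<subseteq> sets M"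
          using C0s As by auto
        show "decseq (\<lambda>k. C0 \<inter> (\<Union>i. A i) - (\<Union>i<k. A i))"
          by (auto simp: decseq_def)
        fix k
        have "C0 \<inter> ((\<Union>i. A i) - (\<Union>i<k. A i)) \<in> fmeasurable M"
          using As by (intro fm) auto
        then show "emeasure M (C0 \<inter> (\<Union>i. A i) - (\<Union>i<k. A i)) \<noteq> \<infinity>"
          using fmeasurableD2 by (simp add: Int_Diff)
      qed
      moreover have "(\<Inter>k. C0 \<inter> (\<Union>i. A i) - (\<Union>i<k. A i)) = {}" by blast
      ultimately have lim: "(\<lambda>k. measure M (C0 \<inter> (\<Union>i. A i) - (\<Union>i<k. A i))) \<longlonglongrightarrow> 0"
        by (simp only: measure_empty)
      have "\<forall>\<^sub>F k in sequentially. measure M (C0 \<inter> (\<Union>i. A i) - (\<Union>i<k. A i)) < \<epsilon> / 2"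
        by (rule order_tendstoD(2)[OF lim]) (use \<open>0 < \<epsilon>\<close> in simp)
      from eventually_happens[OF this] obtain k
        where k: "measure M (C0 \<inter> (\<Union>i. A i) - (\<Union>i<k. A i)) < \<epsilon> / 2"
        by (simp del: Int_UN_distrib UN_simps) blast
      \<comment> \<open>One half of \<epsilon> pays for the tail beyond \<open>k\<close>, the other
        half is shared by the first \<open>k\<close> sets. The denominator contains
        \<open>k + 1\<close> so that \<open>k = 0\<close> is covered as well.\<close>
      have "\<forall>i. \<exists>N. \<forall>n\<ge>N. \<exists>F\<subseteq>D n.
          measure M (C0 \<inter> ((A i - \<Union>F) \<union> (\<Union>F - A i))) < \<epsilon> / (2 * (real k + 1))"
        using union.IH \<open>0 < \<epsilon>\<close> by simp
      from choice[OF this] obtain N where N: "\<And>i n. n \<ge> N i \<Longrightarrow> \<exists>F\<subseteq>D n.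
          measure M (C0 \<inter> ((A i - \<Union>F) \<union> (\<Union>F - A i))) < \<epsilon> / (2 * (real k + 1))"
        by blast
      show "\<exists>N. \<forall>n\<ge>N. \<exists>F\<subseteq>D n.
          measure M (C0 \<inter> (((\<Union>i. A i) - \<Union>F) \<union> (\<Union>F - (\<Union>i. A i)))) < \<epsilon>"
      proof (intro exI[of _ "Max (insert 0 (N ` {..<k}))"] allI impI)
        fix n assume n: "Max (insert 0 (N ` {..<k})) \<le> n"
        have "\<forall>i\<in>{..<k}. \<exists>F\<subseteq>D n.
            measure M (C0 \<inter> ((A i - \<Union>F) \<union> (\<Union>F - A i))) < \<epsilon> / (2 * (real k + 1))"
        proof (intro ballI N)
          fix i assume "i \<in> {..<k}"
          then have "N i \<le> Max (insert 0 (N ` {..<k}))" by (intro Max_ge) simp_all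
          with n show "N i \<le> n" by linarith
        qed
        from bchoice[OF this] obtain F where F: "\<And>i. i < k \<Longrightarrow> F i \<subseteq> D n"
          "\<And>i. i < k \<Longrightarrow> measure M (C0 \<inter> ((A i - \<Union>(F i)) \<union> (\<Union>(F i) - A i))) < \<epsilon> / (2 * (real k + 1))"
          by (simp add: Ball_def) blast
        let ?X = "\<lambda>i. C0 \<inter> ((A i - \<Union>(F i)) \<union> (\<Union>(F i) - A i))"
        let ?F = "\<Union>i<k. F i"
        have Xs: "?X i \<in> fmeasurable M" if "i < k" for i
          using As[of i] Union_D_sets[OF F(1)[OF that]] by (intro fm) auto
        have Rs: "C0 \<inter> (\<Union>i. A i) - (\<Union>i<k. A i) \<in> fmeasurable M"
          using fm[of "(\<Union>i. A i) - (\<Union>i<k. A i)"] As by (simp add: Int_Diff sets.Diff sets.countable_UN image_subset_iff)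
        have "measure M (C0 \<inter> (((\<Union>i. A i) - \<Union>?F) \<union> (\<Union>?F - (\<Union>i. A i))))
            \<le> measure M ((C0 \<inter> (\<Union>i. A i) - (\<Union>i<k. A i)) \<union> (\<Union>i<k. ?X i))"
        proof (rule measure_mono_fmeasurable)
          have "\<Union>?F \<in> sets M" using F(1) by (intro Union_D_sets) auto
          then show "C0 \<inter> (((\<Union>i. A i) - \<Union>?F) \<union> (\<Union>?F - (\<Union>i. A i))) \<in> sets M"
            using C0s As by (intro sets.Int sets.Un sets.Diff sets.countable_UN) auto
          show "(C0 \<inter> (\<Union>i. A i) - (\<Union>i<k. A i)) \<union> (\<Union>i<k. ?X i) \<in> fmeasurable M"
            using Rs Xs by (intro fmeasurable.Un fmeasurable.finite_UN) auto
          show "C0 \<inter> (((\<Union>i. A i) - \<Union>?F) \<union> (\<Union>?F - (\<Union>i. A i)))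
              \<subseteq> (C0 \<inter> (\<Union>i. A i) - (\<Union>i<k. A i)) \<union> (\<Union>i<k. ?X i)"
          proof (intro subsetI)
            fix x assume "x \<in> C0 \<inter> (((\<Union>i. A i) - \<Union>?F) \<union> (\<Union>?F - (\<Union>i. A i)))"
            then consider i where "x \<in> C0" "x \<in> A i" "x \<notin> \<Union>?F"
              | i C where "x \<in> C0" "\<And>j. x \<notin> A j" "i < k" "C \<in> F i" "x \<in> C"
              by auto
            then show "x \<in> (C0 \<inter> (\<Union>i. A i) - (\<Union>i<k. A i)) \<union> (\<Union>i<k. ?X i)"
              by cases auto
          qed
        qed
        also have "\<dots> \<le> measure M (C0 \<inter> (\<Union>i. A i) - (\<Union>i<k. A i)) + measure M (\<Union>i<k. ?X i)"
          using Rs Xs by (intro measure_Un_le fmeasurableD fmeasurable.finite_UN) auto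
        also have "measure M (\<Union>i<k. ?X i) \<le> (\<Sum>i<k. measure M (?X i))"
          using Xs by (intro measure_UNION_le) auto
        also have "\<dots> \<le> (\<Sum>i<k. \<epsilon> / (2 * (real k + 1)))"
          using F(2) by (intro sum_mono less_imp_le) auto
        also have "\<dots> = \<epsilon> / 2 * (real k / (real k + 1))" by simp
        also have "\<dots> \<le> \<epsilon> / 2"
          using \<open>0 < \<epsilon>\<close> by (intro mult_left_le) (auto simp: field_simps)
        finally have "measure M (C0 \<inter> (((\<Union>i. A i) - \<Union>?F) \<union> (\<Union>?F - (\<Union>i. A i)))) < \<epsilon>"
          using k by linarith
        moreover have "?F \<subseteq> D n" using F(1) by (intro UN_least) simp
        ultimately show "\<exists>F\<subseteq>D n.
            measure M (C0 \<inter> (((\<Union>i. A i) - \<Union>F) \<union> (\<Union>F - (\<Union>i. A i)))) < \<epsilon>"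
          by (intro exI[of _ ?F] conjI)
      qed
    qed
  qed
  with \<epsilon> show ?thesis by blast
qed

text \<open>If every cube had at least the fraction \<epsilon> of its mass outside \<open>E\<close>,
  so would every union of cubes of one generation. But such a union can approximate \<open>E\<close>
  inside some \<open>C0\<close>, and then almost none of its mass is outside
  \<open>E\<close>.\<close>

lemma exists_cube_of_high_density:
  assumes E: "E \<in> sets M" "emeasure M E \<noteq> 0" and \<epsilon>: "0 < \<epsilon>"
  shows "\<exists>n. \<exists>C\<in>D n. emeasure M (C - E) < ennreal \<epsilon> * emeasure M C"
proof (rule ccontr)
  assume "\<not> ?thesis"
  then have neg: "ennreal \<epsilon> * emeasure M C \<le> emeasure M (C - E)" if "C \<in> D n" for C n
    using that by (meson not_le)
  have "\<exists>C0\<in>D 0. emeasure M (C0 \<inter> E) \<noteq> 0"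
  proof (rule ccontr)
    assume "\<not> ?thesis"
    then have "C \<inter> E \<in> null_sets M" if "C \<in> D 0" for C
      using that E D_sets[OF that] by (auto simp: null_sets_def)
    then have "(\<Union>C\<in>D 0. C \<inter> E) \<in> null_sets M"
      by (intro null_sets_UN' D_countable)
    moreover have "(\<Union>C\<in>D 0. C \<inter> E) = E"
    proof
      show "E \<subseteq> (\<Union>C\<in>D 0. C \<inter> E)"
      proof
        fix x assume x: "x \<in> E"
        then have "x \<in> space M" using sets.sets_into_space[OF E(1)] by blast
        then obtain C where "C \<in> D 0" "x \<in> C" using D_cover by blast
        with x show "x \<in> (\<Union>C\<in>D 0. C \<inter> E)" by blast
      qed
    qed blast
    ultimately show False using E by (simp add: null_sets_def)
  qed
  then obtain C0 where C0: "C0 \<in> D 0" and pos: "emeasure M (C0 \<inter> E) \<noteq> 0" by blast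
  have C0s [measurable]: "C0 \<in> sets M" "E \<in> sets M" using D_sets[OF C0] E by auto
  have C0f: "C0 \<in> fmeasurable M" using D_finite[OF C0] by (auto simp: fmeasurable_def)
  have fin: "emeasure M (C0 \<inter> B) = ennreal (measure M (C0 \<inter> B))" if "B \<in> sets M" for B
    using fmeasurable_Int_fmeasurable[OF C0f that] by (intro emeasure_eq_ennreal_measure) (simp add: fmeasurableD2)
  define e where "e = measure M (C0 \<inter> E)"
  have e: "0 < e" using pos fin[OF E(1)] by (auto simp: e_def less_le)
  \<comment> \<open>Chosen so that \<open>\<eta> / \<epsilon> + \<eta> = e\<close>, the value
    contradicted by the final strict inequality.\<close>
  define \<eta> where "\<eta> = \<epsilon> * e / (1 + \<epsilon>)"
  have \<eta>: "0 < \<eta>" using e \<epsilon> by (simp add: \<eta>_def)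
  obtain N where N: "\<forall>n\<ge>N. \<exists>F\<subseteq>D n. measure M (C0 \<inter> ((E - \<Union>F) \<union> (\<Union>F - E))) < \<eta>"
    using D_approximation[OF E(1) C0 \<eta>] by blast
  \<comment> \<open>\<open>C0\<close> has generation 0. A generation \<open>n \<ge> 0\<close>
    ensures that the approximating cubes that meet \<open>C0\<close> lie inside it.\<close>
  define n where "n = max N 0"
  have "N \<le> n" "0 \<le> n" by (auto simp: n_def)
  then obtain F where F: "F \<subseteq> D n" "measure M (C0 \<inter> ((E - \<Union>F) \<union> (\<Union>F - E))) < \<eta>"
    using N by blast
  define U where "U = \<Union>F"
  have U [measurable]: "U \<in> sets M" using Union_D_sets[OF F(1)] by (simp add: U_def)
  define F' where "F' = {C\<in>F. C \<subseteq> C0}"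
  have "C \<subseteq> C0" if "C \<in> F" "C \<inter> C0 \<noteq> {}" for C
    using D_nested[OF \<open>0 \<le> n\<close> C0, of C] that F(1) by (auto simp: Int_commute)
  then have F'_eq: "\<Union>F' = C0 \<inter> U" unfolding F'_def U_def by blast
  have F'D: "F' \<subseteq> D n" using F(1) by (auto simp: F'_def)
  define \<nu> where "\<nu> = density M (indicator (space M - E))"
  have dens: "emeasure \<nu> C = emeasure M (C - E)" if [measurable]: "C \<in> sets M" for C
  proof -
    have "emeasure \<nu> C = (\<integral>\<^sup>+x\<in>C. indicator (space M - E) x \<partial>M)"
      unfolding \<nu>_def by (simp add: emeasure_density)
    also have "\<dots> = (\<integral>\<^sup>+x. indicator (C - E) x \<partial>M)"
      by (intro nn_integral_cong) (auto split: split_indicator)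
    finally have "emeasure \<nu> C = (\<integral>\<^sup>+x. indicator (C - E) x \<partial>M)" .
    then show ?thesis by simp
  qed
  have "emeasure M (\<Union>F') \<le> ennreal (1 / \<epsilon>) * emeasure \<nu> (\<Union>F')"
  proof (rule emeasure_disjoint_Union_le)
    show "countable F'" using F'D D_countable countable_subset by blast
    show "disjoint F'" using F'D D_disjoint by (meson pairwise_subset)
    show "F' \<subseteq> sets M" using F'D D_sets by blast
    fix C assume "C \<in> F'"
    then have C: "C \<in> D n" using F'D by auto
    have "emeasure M C = ennreal (1 / \<epsilon>) * (ennreal \<epsilon> * emeasure M C)"
      using \<epsilon> by (simp add: mult.assoc[symmetric] ennreal_mult[symmetric])
    also have "\<dots> \<le> ennreal (1 / \<epsilon>) * emeasure M (C - E)"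
      by (intro mult_left_mono neg[OF C]) simp
    finally show "emeasure M C \<le> ennreal (1 / \<epsilon>) * emeasure \<nu> C"
      using dens D_sets[OF C] by simp
  qed (simp add: \<nu>_def)
  then have "emeasure M (C0 \<inter> U) \<le> ennreal (1 / \<epsilon>) * emeasure M (C0 \<inter> (U - E))"
    using dens[of "C0 \<inter> U"] by (simp add: F'_eq Int_Diff)
  then have "measure M (C0 \<inter> U) \<le> 1 / \<epsilon> * measure M (C0 \<inter> (U - E))"
    using fin[OF U] fin[of "U - E"] \<epsilon> by (simp add: ennreal_mult[symmetric] del: times_divide_eq_left)
  moreover have "measure M (C0 \<inter> (U - E)) \<le> measure M (C0 \<inter> ((E - U) \<union> (U - E)))"
    by (intro measure_mono_fmeasurable fmeasurable_Int_fmeasurable[OF C0f]) auto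
  moreover have "measure M (C0 \<inter> E) \<le> measure M (C0 \<inter> U \<union> C0 \<inter> (E - U))"
    by (intro measure_mono_fmeasurable fmeasurable.Un fmeasurable_Int_fmeasurable[OF C0f]) auto
  moreover have "measure M (C0 \<inter> U \<union> C0 \<inter> (E - U)) \<le> measure M (C0 \<inter> U) + measure M (C0 \<inter> (E - U))"
    by (intro measure_Un_le) auto
  moreover have "measure M (C0 \<inter> (E - U)) \<le> measure M (C0 \<inter> ((E - U) \<union> (U - E)))"
    by (intro measure_mono_fmeasurable fmeasurable_Int_fmeasurable[OF C0f]) auto
  moreover have "measure M (C0 \<inter> ((E - U) \<union> (U - E))) < \<eta>" using F(2) by (simp add: U_def)
  moreover from calculation have "(1 / \<epsilon>) * measure M (C0 \<inter> (U - E)) < (1 / \<epsilon>) * \<eta>"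
    using \<epsilon> by (intro mult_strict_left_mono) auto
  ultimately have "e < (1 / \<epsilon>) * \<eta> + \<eta>"
    unfolding e_def by linarith
  also have "\<dots> = \<eta> * (1 + \<epsilon>) / \<epsilon>" using \<epsilon> by (simp add: field_simps)
  also have "\<dots> = e" using \<epsilon> by (simp add: \<eta>_def)
  finally show False by simp
qed

section \<open>Level sets of the dyadic maximal function and their maximal cubes\<close>

text \<open>This is the set where the dyadic maximal function of \<open>g\<close> exceeds
  \<open>t\<close>. The averages are written without division.\<close>

definition level :: "('a \<Rightarrow> ennreal) \<Rightarrow> ennreal \<Rightarrow> 'a set"
  where "level g t = \<Union>{C \<in> (\<Union>n. D n). t * emeasure M C < (\<integral>\<^sup>+x\<in>C. g x \<partial>M)}"

text \<open>These are the Calderon-Zygmund cubes of height \<open>t\<close>. Maximality is stated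
  through the generations \<open>m < n\<close>, so that nesting and disjointness follow by comparing
  indices.\<close>

definition stopping :: "('a \<Rightarrow> ennreal) \<Rightarrow> ennreal \<Rightarrow> 'a set set"
  where "stopping g t = {C. \<exists>n. C \<in> D n \<and> t * emeasure M C < (\<integral>\<^sup>+x\<in>C. g x \<partial>M) \<and>
    (\<forall>m<n. \<forall>C'\<in>D m. C \<subseteq> C' \<longrightarrow> (\<integral>\<^sup>+x\<in>C'. g x \<partial>M) \<le> t * emeasure M C')}"

lemma level_sets [measurable]: "level g t \<in> sets M"
  unfolding level_def
  by (intro sets.countable_Union countable_subset[OF _ countable_all_D]) (auto intro: D_sets)

lemma stopping_subset_D: "stopping g t \<subseteq> (\<Union>n. D n)"
  by (auto simp: stopping_def)

lemma countable_stopping: "countable (stopping g t)"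
  by (rule countable_subset[OF stopping_subset_D countable_all_D])

lemma stopping_sets: "stopping g t \<subseteq> sets M"
  using stopping_subset_D D_sets by blast

lemma Union_stopping_subset_level: "\<Union>(stopping g t) \<subseteq> level g t"
  unfolding level_def stopping_def by blast

text \<open>Otherwise \<open>C'\<close> would be a coarser cube around \<open>C\<close> with average
  above \<open>t \<ge> s\<close>, which the maximality of \<open>C\<close> at height
  \<open>s\<close> excludes. The case \<open>s = t\<close> yields disjointness; the case
  \<open>s < t\<close> places the cubes of a higher level inside those of a lower one.\<close>

lemma stopping_nested:
  assumes "s \<le> t" "C \<in> stopping g s" "C' \<in> stopping g t" "C \<inter> C' \<noteq> {}"
  shows "C' \<subseteq> C"
proof -
  obtain n where n: "C \<in> D n"
    "\<And>m C'. m < n \<Longrightarrow> C' \<in> D m \<Longrightarrow> C \<subseteq> C' \<Longrightarrow> (\<integral>\<^sup>+x\<in>C'. g x \<partial>M) \<le> s * emeasure M C'"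
    using assms(2) unfolding stopping_def by blast
  obtain n' where n': "C' \<in> D n'" "t * emeasure M C' < (\<integral>\<^sup>+x\<in>C'. g x \<partial>M)"
    using assms(3) unfolding stopping_def by blast
  show ?thesis
  proof (cases "n \<le> n'")
    case True
    then show ?thesis using D_nested[OF _ n(1) n'(1)] assms(4) by blast
  next
    case False
    then have "C \<subseteq> C'"
      using D_nested[OF _ n'(1) n(1)] assms(4) by (simp add: Int_commute)
    then have "(\<integral>\<^sup>+x\<in>C'. g x \<partial>M) \<le> s * emeasure M C'"
      using n(2)[of n' C'] n'(1) False by simp
    also have "\<dots> \<le> t * emeasure M C'" using assms(1) by (intro mult_right_mono) auto
    finally show ?thesis using n'(2) by simp
  qed
qed

lemma disjoint_stopping: "disjoint (stopping g t)"
proof (rule disjointI)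
  fix a b assume "a \<in> stopping g t" "b \<in> stopping g t" "a \<noteq> b"
  then show "a \<inter> b = {}"
    using stopping_nested[of t t a g b] stopping_nested[of t t b g a] by (auto simp: Int_commute)
qed

text \<open>By \<open>bound\<close>, the generations whose cube around \<open>x\<close> has a large
  average are bounded from below, so there is a coarsest one. The weighted setting below provides
  the hypothesis.\<close>

lemma in_Union_stopping:
  assumes x: "x \<in> level g t"
    and bound: "\<And>m. m \<le> m0 \<Longrightarrow> (\<integral>\<^sup>+y\<in>cube m x. g y \<partial>M) \<le> t * emeasure M (cube m x)"
  shows "x \<in> \<Union>(stopping g t)"
proof -
  define P where "P m \<longleftrightarrow> t * emeasure M (cube m x) < (\<integral>\<^sup>+y\<in>cube m x. g y \<partial>M)" for m
  obtain n C where C: "C \<in> D n" "x \<in> C" "t * emeasure M C < (\<integral>\<^sup>+y\<in>C. g y \<partial>M)"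
    using x unfolding level_def by blast
  have Pn: "P n" using C cube_eq[OF C(1,2)] by (simp add: P_def)
  have lower: "m0 < m" if "P m" for m
    using bound[of m] that unfolding P_def by (meson not_le)
  define S where "S = {m. m \<le> n \<and> P m}"
  have fin: "finite S" by (rule finite_subset[of _ "{m0..n}"]) (auto simp: S_def dest: lower)
  have "n \<in> S" using Pn by (simp add: S_def)
  then have Min: "Min S \<in> S" "\<And>m. m \<in> S \<Longrightarrow> Min S \<le> m" using fin by (auto intro!: Min_in)
  have xs: "x \<in> space M" using C D_subset_space by blast
  have "cube (Min S) x \<in> stopping g t"
    unfolding stopping_def
  proof (intro CollectI exI conjI allI impI ballI)
    show "cube (Min S) x \<in> D (Min S)" by (rule cube_in[OF xs])
    show "t * emeasure M (cube (Min S) x) < (\<integral>\<^sup>+y\<in>cube (Min S) x. g y \<partial>M)"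
      using Min(1) by (simp add: S_def P_def)
    fix m C' assume m: "m < Min S" "C' \<in> D m" "cube (Min S) x \<subseteq> C'"
    then have "C' = cube m x" using cube_eq in_cube[OF xs] by blast
    moreover have "\<not> P m"
    proof
      assume "P m"
      then have "m \<in> S" using m(1) Min(1) by (auto simp: S_def)
      then show False using Min(2)[of m] m(1) by simp
    qed
    ultimately show "(\<integral>\<^sup>+y\<in>C'. g y \<partial>M) \<le> t * emeasure M C'" by (simp add: P_def not_less)
  qed
  then show ?thesis using in_cube[OF xs] by blast
qed

text \<open>A dyadic form of Lebesgue's differentiation theorem.\<close>

lemma superlevel_minus_level_null:
  assumes [measurable]: "g \<in> borel_measurable M" and st: "0 \<le> s" "s < t"
  shows "{x \<in> space M. ennreal t < g x} - level g (ennreal s) \<in> null_sets M"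
proof (rule ccontr)
  define E where "E = {x \<in> space M. ennreal t < g x} - level g (ennreal s)"
  have E [measurable]: "E \<in> sets M" unfolding E_def by measurable
  assume "\<not> ?thesis"
  then have "emeasure M E \<noteq> 0" using E by (auto simp: E_def[symmetric] null_sets_def)
  \<comment> \<open>If less than the fraction \<open>(t - s) / t\<close> of \<open>C\<close> is
    outside \<open>E\<close>, more than the fraction \<open>s / t\<close> is inside, where
    \<open>g\<close> exceeds \<open>t\<close>. Hence the average of \<open>g\<close> over
    \<open>C\<close> exceeds \<open>s\<close>, and \<open>C\<close> lies in the level set that
    \<open>E\<close> avoids.\<close>
  moreover have "0 < (t - s) / t" using st by simp
  ultimately obtain n C where C: "C \<in> D n" and less: "emeasure M (C - E) < ennreal ((t - s) / t) * emeasure M C"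
    using exists_cube_of_high_density[OF E] by blast
  have Cs [measurable]: "C \<in> sets M" by (rule D_sets[OF C])
  have Cf: "C \<in> fmeasurable M" using D_finite[OF C] by (auto simp: fmeasurable_def)
  have meas: "emeasure M (C - E) = ennreal (measure M (C - E))" "emeasure M (C \<inter> E) = ennreal (measure M (C \<inter> E))"
    using fmeasurableI2[OF Cf, of "C - E"] fmeasurableI2[OF Cf, of "C \<inter> E"]
    by (auto intro!: emeasure_eq_ennreal_measure simp: fmeasurableD2)
  have "measure M (C - E) < (t - s) / t * measure M C"
    using less st meas(1) emeasure_D_real[OF C]
    by (simp add: ennreal_mult[symmetric] ennreal_less_iff del: times_divide_eq_left)
  moreover have "measure M (C \<inter> E \<union> (C - E)) = measure M (C \<inter> E) + measure M (C - E)"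
    by (rule measure_Union) (use meas in auto)
  then have "measure M C = measure M (C - E) + measure M (C \<inter> E)"
    by (simp add: Int_Diff_Un add.commute)
  ultimately have "s * measure M C < t * measure M (C \<inter> E)"
    using st by (simp add: field_simps)
  then have lt: "ennreal s * emeasure M C < ennreal t * emeasure M (C \<inter> E)"
    using st emeasure_D_real[OF C] meas(2) by (simp add: ennreal_mult[symmetric] ennreal_less_iff)
  have "ennreal t * emeasure M (C \<inter> E) = (\<integral>\<^sup>+x. ennreal t * indicator (C \<inter> E) x \<partial>M)"
    by (simp add: nn_integral_cmult_indicator)
  also have "\<dots> \<le> (\<integral>\<^sup>+x\<in>C. g x \<partial>M)"
    by (intro nn_integral_mono) (auto simp: E_def split: split_indicator)
  finally have "ennreal s * emeasure M C < (\<integral>\<^sup>+x\<in>C. g x \<partial>M)"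
    using lt by (rule less_le_trans[rotated])
  then have "C \<subseteq> level g (ennreal s)" using C unfolding level_def by blast
  then have "C \<inter> E = {}" by (auto simp: E_def)
  then show False using lt by simp
qed

end

subsection \<open>The good-lambda inequality\<close>

text \<open>Multiplied out, \<open>muckenhoupt\<close> says that the \<open>r\<close>-th power of
  the \<open>M\<close>-mean of \<open>h\<close> over a cube is at most \<open>A\<close> times the
  \<open>W\<close>-mean of the \<open>r\<close>-th power of \<open>h\<close>. This form of the A_r
  condition needs no dual weight: indicators \<open>h\<close> compare the two measures, and
  \<open>h = g\<close> gives the weak type inequality.\<close>

locale weighted_dyadic_lattice = dyadic_lattice M D K
  for M :: "'a measure" and D K +
  fixes W :: "'a measure" and r A :: real
  assumes sets_W: "sets W = sets M"
    and W_null: "N \<in> null_sets M \<Longrightarrow> N \<in> null_sets W"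
    and W_pos: "C \<in> D n \<Longrightarrow> 0 < emeasure W C"
    and W_finite: "C \<in> D n \<Longrightarrow> emeasure W C < \<infinity>"
    and A_ge: "1 \<le> A" and r_pos: "0 < r"
    and muckenhoupt: "h \<in> borel_measurable M \<Longrightarrow> C \<in> D n \<Longrightarrow>
      epow (\<integral>\<^sup>+x\<in>C. h x \<partial>M) r * emeasure W C
        \<le> ennreal A * epow (emeasure M C) r * (\<integral>\<^sup>+x\<in>C. epow (h x) r \<partial>W)"
begin

lemma measurable_W [simp]: "borel_measurable W = borel_measurable M"
  by (intro measurable_cong_sets sets_W) simp

lemma space_W: "space W = space M"
  by (rule sets_eq_imp_space_eq[OF sets_W])

definition \<delta> :: real where "\<delta> = 1 - (1 / 2) powr r / A"

lemma \<delta>_pos: "0 < \<delta>" and \<delta>_less_1: "\<delta> < 1"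
proof -
  have "(1 / 2) powr r < 1 powr r" using r_pos by (intro powr_less_mono2) auto
  then have "(1 / 2) powr r < A" using A_ge by simp
  then show "0 < \<delta>" using A_ge by (simp add: \<delta>_def field_simps)
  show "\<delta> < 1" using A_ge by (simp add: \<delta>_def)
qed

lemma emeasure_W_real:
  assumes "C \<in> D n"
  shows "emeasure W C = ennreal (measure W C)" "0 < measure W C"
proof -
  show "emeasure W C = ennreal (measure W C)"
    using W_finite[OF assms] by (intro emeasure_eq_ennreal_measure) simp
  then show "0 < measure W C" using W_pos[OF assms] by simp
qed

text \<open>The condition is tested on the indicator of \<open>C - E\<close>, which carries at least
  half of the mass of \<open>C\<close>. So at least the fraction \<open>(1 / 2) powr r / A\<close>
  of the weight lies outside \<open>E\<close>, and \<delta> is what remains.\<close>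

lemma emeasure_W_small_subset:
  assumes C: "C \<in> D n" and E: "E \<in> sets M" "E \<subseteq> C"
    and small: "2 * emeasure M E \<le> emeasure M C"
  shows "emeasure W E \<le> ennreal \<delta> * emeasure W C"
proof -
  have Cs [measurable]: "C \<in> sets M" "E \<in> sets M" using D_sets[OF C] E by auto
  note m = emeasure_D_real[OF C] and w = emeasure_W_real[OF C]
  have Cf: "C \<in> fmeasurable M" "C \<in> fmeasurable W"
    using D_finite[OF C] W_finite[OF C] sets_W by (auto simp: fmeasurable_def)
  have CE: "E \<in> fmeasurable M" "C - E \<in> fmeasurable M" "E \<in> fmeasurable W" "C - E \<in> fmeasurable W"
    using E sets_W by (auto intro!: fmeasurableI2[OF Cf(1)] fmeasurableI2[OF Cf(2)])
  have meas: "emeasure M E = ennreal (measure M E)" "emeasure M (C - E) = ennreal (measure M (C - E))"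
    "emeasure W E = ennreal (measure W E)" "emeasure W (C - E) = ennreal (measure W (C - E))"
    using CE by (auto intro!: emeasure_eq_ennreal_measure simp: fmeasurableD2)
  have M_diff: "measure M (C - E) = measure M C - measure M E"
    using measure_Diff[of M C E] E m by auto
  have W_diff: "measure W (C - E) = measure W C - measure W E"
    using measure_Diff[of W C E] E w sets_W by auto
  have half: "measure M C / 2 \<le> measure M C - measure M E"
    using small m meas(1) by (simp add: ennreal_mult''[symmetric] ennreal_le_iff numeral_mult_ennreal)
  have ind: "epow (indicator (C - E) x) r = indicator (C - E) x" for x
    using epow_ennreal[of 1 r] by (auto split: split_indicator)
  have "(\<integral>\<^sup>+x\<in>C. indicator (C - E) x \<partial>N) = (\<integral>\<^sup>+x. indicator (C - E) x \<partial>N)" for N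
    by (intro nn_integral_cong) (auto split: split_indicator)
  then have int: "(\<integral>\<^sup>+x\<in>C. indicator (C - E) x \<partial>M) = emeasure M (C - E)"
    "(\<integral>\<^sup>+x\<in>C. indicator (C - E) x \<partial>W) = emeasure W (C - E)"
    using sets_W by simp_all
  have "epow (emeasure M (C - E)) r * emeasure W C
      \<le> ennreal A * epow (emeasure M C) r * emeasure W (C - E)"
    using muckenhoupt[of "indicator (C - E)", OF _ C] unfolding ind int by simp
  then have "(measure M (C - E)) powr r * measure W C
      \<le> A * (measure M C) powr r * measure W (C - E)"
    using m(1) w(1) meas A_ge by (simp add: epow_ennreal ennreal_mult''[symmetric] ennreal_mult'[symmetric])
  moreover have "(measure M C / 2) powr r * measure W C \<le> (measure M (C - E)) powr r * measure W C"
    using half m r_pos by (intro mult_right_mono powr_mono2) (auto simp: M_diff)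
  ultimately have "(measure M C) powr r * ((1 / 2) powr r * measure W C)
      \<le> (measure M C) powr r * (A * (measure W C - measure W E))"
    using m by (simp add: W_diff powr_divide mult_ac)
  then have "(1 / 2) powr r * measure W C \<le> A * (measure W C - measure W E)"
    using m by (subst (asm) mult_le_cancel_left_pos) auto
  then have "measure W E \<le> \<delta> * measure W C"
    using A_ge by (simp add: \<delta>_def field_simps)
  then show ?thesis
    using meas w \<delta>_pos by (simp add: ennreal_mult''[symmetric] ennreal_leI)
qed

text \<open>If the supremum \<open>s\<close> of these weights were finite, some cube around
  \<open>x\<close> would have weight above \<delta> times \<open>s\<close>. An ancestor with at
  least twice its \<mu>-measure has weight at most \<open>s\<close>, and the half-mass estimate
  forces the smaller cube down to \<delta> times \<open>s\<close>.\<close>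

lemma W_unbounded:
  assumes x: "x \<in> space M"
  shows "\<exists>n. ennreal B < emeasure W (cube n x)"
proof (rule ccontr)
  assume "\<not> ?thesis"
  then have le: "emeasure W (cube n x) \<le> ennreal B" for n by (simp add: not_less)
  define s where "s = (SUP n. emeasure W (cube n x))"
  have "s \<le> ennreal B" unfolding s_def by (intro SUP_least le)
  then obtain s' where s': "s = ennreal s'" "0 \<le> s'" by (cases s) (auto simp: top_unique)
  have "emeasure W (cube 0 x) \<le> s" unfolding s_def by (rule SUP_upper) simp
  then have "0 < s'" using W_pos[OF cube_in[OF x, of 0]] s' by (auto simp: less_le)
  then have "ennreal \<delta> * s < s"
    using \<delta>_less_1 \<delta>_pos s' by (simp add: ennreal_mult[symmetric] ennreal_less_iff)
  then obtain n where n: "ennreal \<delta> * s < emeasure W (cube n x)"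
    unfolding s_def less_SUP_iff by blast
  obtain m C where C: "C \<in> D m" "x \<in> C" "ennreal (2 * measure M (cube n x)) < emeasure M C"
    using D_unbounded[OF x] by blast
  have Ceq: "C = cube m x" using cube_eq[OF C(1,2)] by simp
  have big: "2 * emeasure M (cube n x) \<le> emeasure M C"
    using C(3) emeasure_D_real[OF cube_in[OF x, of n]] by (simp add: ennreal_mult)
  have "m \<le> n"
  proof (rule ccontr)
    assume "\<not> m \<le> n"
    then have "emeasure M C \<le> emeasure M (cube n x)"
      unfolding Ceq using cube_antimono[OF x, of n m] D_sets[OF cube_in[OF x]]
      by (intro emeasure_mono) auto
    with C(3) emeasure_D_real[OF cube_in[OF x, of n]] emeasure_D_real[OF C(1)] show False
      by (simp add: ennreal_less_iff)
  qed
  then have "emeasure W (cube n x) \<le> ennreal \<delta> * emeasure W C"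
    using big Ceq cube_antimono[OF x, of m n]
    by (intro emeasure_W_small_subset[OF C(1)] D_sets[OF cube_in[OF x]]) auto
  also have "\<dots> \<le> ennreal \<delta> * s"
    unfolding s_def Ceq by (intro mult_left_mono SUP_upper) auto
  finally show False using n by simp
qed

lemma weak_type_cube:
  assumes [measurable]: "g \<in> borel_measurable M" and C: "C \<in> D n" and t: "0 < t"
    and le: "ennreal t * emeasure M C \<le> (\<integral>\<^sup>+x\<in>C. g x \<partial>M)"
  shows "ennreal (t powr r) * emeasure W C \<le> ennreal A * (\<integral>\<^sup>+x\<in>C. epow (g x) r \<partial>W)"
proof -
  note m = emeasure_D_real[OF C]
  let ?m = "measure M C powr r" and ?I = "\<integral>\<^sup>+x\<in>C. epow (g x) r \<partial>W"
  have "ennreal ?m * (ennreal (t powr r) * emeasure W C) = epow (ennreal t * emeasure M C) r * emeasure W C"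
    using t m by (simp add: epow_mult epow_ennreal mult_ac)
  also have "\<dots> \<le> epow (\<integral>\<^sup>+x\<in>C. g x \<partial>M) r * emeasure W C"
    using le r_pos by (intro mult_right_mono epow_mono) auto
  also have "\<dots> \<le> ennreal A * epow (emeasure M C) r * ?I"
    by (rule muckenhoupt[OF _ C]) simp
  also have "\<dots> = ennreal ?m * (ennreal A * ?I)"
    using m by (simp add: epow_ennreal mult_ac)
  finally show ?thesis
    using m by (subst (asm) ennreal_mult_le_mult_iff) auto
qed

text \<open>A cube whose average exceeds \<open>t\<close> has weight at most
  \<open>A * J / t powr r\<close>. By \<open>W_unbounded\<close> and monotonicity, every ancestor
  from generation \<open>m0\<close> upwards is heavier, so none of these has a large average and a
  maximal cube exists.\<close>

lemma level_eq_Union_stopping: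
  assumes g [measurable]: "g \<in> borel_measurable M" and t: "0 < t"
    and fin: "(\<integral>\<^sup>+x. epow (g x) r \<partial>W) < \<infinity>"
  shows "level g (ennreal t) = \<Union>(stopping g (ennreal t))"
proof
  show "level g (ennreal t) \<subseteq> \<Union>(stopping g (ennreal t))"
  proof
    fix x assume x: "x \<in> level g (ennreal t)"
    then have xs: "x \<in> space M" using level_sets sets.sets_into_space by blast
    obtain J where J: "(\<integral>\<^sup>+x. epow (g x) r \<partial>W) = ennreal J" "0 \<le> J"
      using fin by (cases "\<integral>\<^sup>+x. epow (g x) r \<partial>W") auto
    obtain m0 where m0: "ennreal (A * J / t powr r) < emeasure W (cube m0 x)"
      using W_unbounded[OF xs] by blast
    show "x \<in> \<Union>(stopping g (ennreal t))"
    proof (rule in_Union_stopping[OF x])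
      fix m assume m: "m \<le> m0"
      show "(\<integral>\<^sup>+y\<in>cube m x. g y \<partial>M) \<le> ennreal t * emeasure M (cube m x)"
      proof (rule ccontr)
        assume "\<not> ?thesis"
        then have "ennreal (t powr r) * emeasure W (cube m x)
            \<le> ennreal A * (\<integral>\<^sup>+y\<in>cube m x. epow (g y) r \<partial>W)"
          using t by (intro weak_type_cube[OF g cube_in[OF xs]]) auto
        also have "\<dots> \<le> ennreal A * (\<integral>\<^sup>+y. epow (g y) r \<partial>W)"
          by (intro mult_left_mono nn_integral_mono) (auto split: split_indicator)
        also have "\<dots> = ennreal (A * J)" using J A_ge by (simp add: ennreal_mult)
        finally have "ennreal (t powr r) * emeasure W (cube m x) \<le> ennreal (A * J)" .
        then have "emeasure W (cube m x) \<le> ennreal (A * J / t powr r)"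
          using t emeasure_W_real[OF cube_in[OF xs, of m]] A_ge J
          by (simp add: ennreal_mult[symmetric] field_simps)
        moreover have "emeasure W (cube m0 x) \<le> emeasure W (cube m x)"
          using cube_antimono[OF xs m] D_sets[OF cube_in[OF xs, of m]] sets_W
          by (intro emeasure_mono) auto
        ultimately show False using m0 by simp
      qed
    qed
  qed
qed (rule Union_stopping_subset_level)

text \<open>The bounds on single stopping cubes add up by disjointness. The result serves to make
  the sequence of weighted level measures finite and bounded; the value of the bound disappears when
  the recursion is iterated.\<close>

lemma weak_type:
  assumes g [measurable]: "g \<in> borel_measurable M" and t: "0 < t"
    and fin: "(\<integral>\<^sup>+x. epow (g x) r \<partial>W) < \<infinity>"
  shows "ennreal (t powr r) * emeasure W (level g (ennreal t))
    \<le> ennreal A * (\<integral>\<^sup>+x. epow (g x) r \<partial>W)"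
proof -
  define \<nu> where "\<nu> = density W (\<lambda>x. epow (g x) r)"
  have gW [measurable]: "g \<in> borel_measurable W" by simp
  have \<nu>: "emeasure \<nu> C = (\<integral>\<^sup>+x\<in>C. epow (g x) r \<partial>W)" if "C \<in> sets M" for C
    unfolding \<nu>_def using that sets_W by (intro emeasure_density) auto
  have tp: "0 < t powr r" using t by simp
  have cancel: "ennreal (t powr r) * (ennreal (1 / t powr r) * a) = a" for a
    using tp by (simp add: mult.assoc[symmetric] ennreal_mult[symmetric])
  have "emeasure W (\<Union>(stopping g (ennreal t)))
      \<le> ennreal (A / t powr r) * emeasure \<nu> (\<Union>(stopping g (ennreal t)))"
  proof (rule emeasure_disjoint_Union_le[OF countable_stopping disjoint_stopping])
    fix C assume C: "C \<in> stopping g (ennreal t)"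
    then obtain n where n: "C \<in> D n" "ennreal t * emeasure M C < (\<integral>\<^sup>+x\<in>C. g x \<partial>M)"
      unfolding stopping_def by blast
    have "emeasure W C = ennreal (1 / t powr r) * (ennreal (t powr r) * emeasure W C)"
      using cancel by (simp add: mult_ac)
    also have "\<dots> \<le> ennreal (1 / t powr r) * (ennreal A * (\<integral>\<^sup>+x\<in>C. epow (g x) r \<partial>W))"
      using n t by (intro mult_left_mono weak_type_cube) auto
    also have "\<dots> = ennreal (A / t powr r) * emeasure \<nu> C"
      using \<nu>[OF D_sets[OF n(1)]] tp A_ge by (simp add: mult.assoc[symmetric] ennreal_mult[symmetric])
    finally show "emeasure W C \<le> ennreal (A / t powr r) * emeasure \<nu> C" .
  qed (use stopping_sets sets_W in \<open>auto simp: \<nu>_def\<close>)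
  also have "\<dots> \<le> ennreal (A / t powr r) * emeasure \<nu> (space \<nu>)"
    by (intro mult_left_mono emeasure_space) auto
  also have "emeasure \<nu> (space \<nu>) = (\<integral>\<^sup>+x. epow (g x) r \<partial>W)"
    unfolding \<nu>_def by (simp add: emeasure_density cong: nn_integral_cong)
  finally have "emeasure W (level g (ennreal t)) \<le> ennreal (A / t powr r) * (\<integral>\<^sup>+x. epow (g x) r \<partial>W)"
    by (simp add: level_eq_Union_stopping[OF g t fin])
  then have "ennreal (t powr r) * emeasure W (level g (ennreal t))
      \<le> ennreal (t powr r) * (ennreal (A / t powr r) * (\<integral>\<^sup>+x. epow (g x) r \<partial>W))"
    by (intro mult_left_mono) auto
  also have "\<dots> = ennreal A * (\<integral>\<^sup>+x. epow (g x) r \<partial>W)"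
    using tp A_ge by (simp add: mult.assoc[symmetric] ennreal_mult[symmetric])
  finally show ?thesis .
qed

text \<open>The parent \<open>P\<close> of \<open>C\<close> has average at most \<open>t\<close>, by
  maximality of \<open>C\<close>. Averaging \<open>tri\<close> in \<open>y\<close> over
  \<open>P\<close> thus bounds \<open>g z\<close> by the mean oscillation at \<open>z\<close> plus
  \<open>t\<close>. Integrated over the part \<open>V\<close> of \<open>C\<close> where the level is
  \<open>b * t\<close>, this reads \<open>b * t * |V| \<le> c * t * |P| + t * |V|\<close>, that is,
  \<open>(b - 1) * |V| \<le> c * |P|\<close>.\<close>

lemma emeasure_level_in_stopping_cube:
  assumes g [measurable]: "g \<in> borel_measurable M"
    and fin: "(\<integral>\<^sup>+x. epow (g x) r \<partial>W) < \<infinity>"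
    and \<kappa> [measurable]: "case_prod \<kappa> \<in> borel_measurable (M \<Otimes>\<^sub>M M)"
    and tri: "\<And>z y. g z \<le> \<kappa> z y + g y"
    and t: "0 < t" and b: "1 < b"
    and C: "C \<in> stopping g (ennreal t)"
    and osc: "\<And>n P. P \<in> D n \<Longrightarrow> C \<subseteq> P \<Longrightarrow> (\<integral>\<^sup>+z\<in>P. (\<integral>\<^sup>+y\<in>P. \<kappa> z y \<partial>M) \<partial>M)
      \<le> ennreal ((b - 1) / (2 * K) * t) * (emeasure M P)\<^sup>2"
  shows "2 * emeasure M (C \<inter> level g (ennreal (b * t))) \<le> emeasure M C"
proof -
  \<comment> \<open>Sigma-finiteness makes the inner integral \<open>H\<close> of the kernel
    measurable.\<close>
  interpret M: sigma_finite_measure M by (rule sigma_finite_measure_M)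
  define c where "c = (b - 1) / (2 * K)"
  have c: "0 < c" using b K_pos by (simp add: c_def)
  obtain n where n: "C \<in> D n"
    "\<And>m C'. m < n \<Longrightarrow> C' \<in> D m \<Longrightarrow> C \<subseteq> C' \<Longrightarrow> (\<integral>\<^sup>+x\<in>C'. g x \<partial>M) \<le> ennreal t * emeasure M C'"
    using C unfolding stopping_def by blast
  obtain x where x: "x \<in> C" using D_nonempty[OF n(1)] by blast
  have xs: "x \<in> space M" using x D_subset_space[OF n(1)] by blast
  define P where "P = cube (n - 1) x"
  have P: "P \<in> D (n - 1)" unfolding P_def by (rule cube_in[OF xs])
  have CP: "C \<subseteq> P"
    using cube_antimono[OF xs, of "n - 1" n] cube_eq[OF n(1) x] by (simp add: P_def)
  have Ps [measurable]: "P \<in> sets M" by (rule D_sets[OF P])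
  note mP = emeasure_D_real[OF P] and mC = emeasure_D_real[OF n(1)]
  have avg: "(\<integral>\<^sup>+y\<in>P. g y \<partial>M) \<le> ennreal t * emeasure M P"
    by (rule n(2)[OF _ P CP]) simp
  define H where "H z = (\<integral>\<^sup>+y\<in>P. \<kappa> z y \<partial>M)" for z
  have H [measurable]: "H \<in> borel_measurable M"
    unfolding H_def by measurable
  have gH: "emeasure M P * g z \<le> H z + ennreal t * emeasure M P" if z [simp]: "z \<in> space M" for z
  proof -
    have [measurable]: "(\<lambda>y. \<kappa> z y) \<in> borel_measurable M" by measurable
    have "emeasure M P * g z = (\<integral>\<^sup>+y\<in>P. g z \<partial>M)"
      by (simp add: nn_integral_cmult_indicator mult.commute)
    also have "\<dots> \<le> (\<integral>\<^sup>+y. \<kappa> z y * indicator P y + g y * indicator P y \<partial>M)"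
      by (intro nn_integral_mono) (auto simp: tri split: split_indicator)
    also have "\<dots> = H z + (\<integral>\<^sup>+y\<in>P. g y \<partial>M)"
      unfolding H_def by (intro nn_integral_add) auto
    finally show ?thesis using avg by (meson add_left_mono order_trans)
  qed
  \<comment> \<open>A stopping cube of the higher level that meets \<open>C\<close> lies inside it,
    so the level set inside \<open>C\<close> is the disjoint union of these cubes, and the lower
    bound \<open>b * t\<close> for the mean of \<open>g\<close> passes to the union.\<close>
  define S where "S = {C' \<in> stopping g (ennreal (b * t)). C' \<subseteq> C}"
  define V where "V = \<Union>S"
  have SD: "C' \<in> sets M" if "C' \<in> S" for C'
    using that stopping_sets[of g "ennreal (b * t)"] by (auto simp: S_def)
  have countS: "countable S" unfolding S_def by (rule countable_subset[OF _ countable_stopping]) auto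
  have Vs [measurable]: "V \<in> sets M"
    unfolding V_def using countS SD by (intro sets.countable_Union) auto
  have bt: "0 < b * t" using b t by simp
  have V: "C \<inter> level g (ennreal (b * t)) = V"
  proof
    show "V \<subseteq> C \<inter> level g (ennreal (b * t))"
      using Union_stopping_subset_level[of g "ennreal (b * t)"] by (auto simp: V_def S_def)
    show "C \<inter> level g (ennreal (b * t)) \<subseteq> V"
    proof
      fix y assume y: "y \<in> C \<inter> level g (ennreal (b * t))"
      then obtain C' where C': "C' \<in> stopping g (ennreal (b * t))" "y \<in> C'"
        by (auto simp: level_eq_Union_stopping[OF g bt fin])
      have "C' \<subseteq> C"
        using y C' b t by (intro stopping_nested[OF _ C C'(1)]) (auto intro!: ennreal_leI)
      with C' show "y \<in> V" by (auto simp: V_def S_def)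
    qed
  qed
  have VC: "V \<subseteq> C" unfolding V_def S_def by auto
  have "C \<in> fmeasurable M"
    using D_finite[OF n(1)] D_sets[OF n(1)] by (simp add: fmeasurable_def)
  then have Vf: "V \<in> fmeasurable M" by (rule fmeasurableI2[OF _ VC Vs])
  have mV: "emeasure M V = ennreal (measure M V)"
    using Vf by (intro emeasure_eq_ennreal_measure) (simp add: fmeasurableD2)
  define \<nu> where "\<nu> = density M g"
  have \<nu>: "emeasure \<nu> B = (\<integral>\<^sup>+x\<in>B. g x \<partial>M)" if "B \<in> sets M" for B
    unfolding \<nu>_def using that by (intro emeasure_density) auto
  have inv: "ennreal (1 / (b * t)) * (ennreal (b * t) * a) = a" for a
  proof -
    have "ennreal (1 / (b * t)) * ennreal (b * t) = 1"
      using bt by (subst ennreal_mult[symmetric]) (auto simp: less_imp_neq[symmetric])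
    then show ?thesis by (simp only: mult.assoc[symmetric] mult_1)
  qed
  have "emeasure M (\<Union>S) \<le> ennreal (1 / (b * t)) * emeasure \<nu> (\<Union>S)"
  proof (rule emeasure_disjoint_Union_le[OF countS])
    show "disjoint S"
      by (rule pairwise_subset[OF disjoint_stopping[of g "ennreal (b * t)"]]) (auto simp: S_def)
    show "S \<subseteq> sets M" using SD by blast
    show "sets \<nu> = sets M" by (simp add: \<nu>_def)
    fix C' assume C': "C' \<in> S"
    then have "ennreal (b * t) * emeasure M C' \<le> emeasure \<nu> C'"
      unfolding \<nu>[OF SD[OF C']] S_def stopping_def by (auto intro: less_imp_le)
    then have "ennreal (1 / (b * t)) * (ennreal (b * t) * emeasure M C') \<le> ennreal (1 / (b * t)) * emeasure \<nu> C'"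
      by (intro mult_left_mono) auto
    then show "emeasure M C' \<le> ennreal (1 / (b * t)) * emeasure \<nu> C'" unfolding inv .
  qed
  \<comment> \<open>The factor \<open>emeasure M P\<close> is carried along so that
    \<open>gH\<close> applies without a division in \<open>ennreal\<close>.\<close>
  then have "emeasure M P * (ennreal (b * t) * emeasure M V)
      \<le> emeasure M P * (ennreal (b * t) * (ennreal (1 / (b * t)) * emeasure \<nu> V))"
    unfolding V_def by (intro mult_left_mono) auto
  also have "\<dots> = emeasure M P * (\<integral>\<^sup>+z\<in>V. g z \<partial>M)"
    unfolding \<nu>[OF Vs, symmetric] by (subst (2) mult.left_commute) (simp only: inv)
  also have "\<dots> = (\<integral>\<^sup>+z\<in>V. emeasure M P * g z \<partial>M)"
    by (subst nn_integral_cmult[symmetric]) (auto simp: mult_ac)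
  also have "\<dots> \<le> (\<integral>\<^sup>+z. H z * indicator P z + ennreal t * emeasure M P * indicator V z \<partial>M)"
    using gH VC CP by (intro nn_integral_mono) (auto split: split_indicator)
  also have "\<dots> = (\<integral>\<^sup>+z\<in>P. H z \<partial>M) + ennreal t * emeasure M P * emeasure M V"
    by (simp add: nn_integral_add nn_integral_cmult_indicator)
  also have "\<dots> \<le> ennreal (c * t) * (emeasure M P)\<^sup>2 + ennreal t * emeasure M P * emeasure M V"
    unfolding H_def c_def by (intro add_right_mono osc[OF P CP])
  finally have "measure M P * (b * t * measure M V)
      \<le> c * t * (measure M P)\<^sup>2 + t * measure M P * measure M V"
    using mP mV b t c
    by (simp add: ennreal_mult[symmetric] ennreal_plus[symmetric] ennreal_power del: ennreal_plus)
  then have "(t * measure M P) * ((b - 1) * measure M V) \<le> (t * measure M P) * (c * measure M P)"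
    by (simp add: algebra_simps power2_eq_square)
  then have 1: "(b - 1) * measure M V \<le> c * measure M P"
    using t mP by (subst (asm) mult_le_cancel_left_pos) auto
  \<comment> \<open>Passing from the parent back to \<open>C\<close> costs the factor
    \<open>K\<close>; the denominator \<open>2 * K\<close> in \<open>c\<close> turns the bound into
    half of the mass of \<open>C\<close>.\<close>
  have "emeasure M P \<le> ennreal K * emeasure M C" by (rule D_parent[OF n(1) P CP])
  then have "measure M P \<le> K * measure M C"
    using mP mC K_pos by (simp add: ennreal_mult[symmetric])
  then have "c * measure M P \<le> c * (K * measure M C)" using c by (intro mult_left_mono) auto
  also have "\<dots> = (b - 1) * (measure M C / 2)" using K_pos by (simp add: c_def field_simps)
  finally have "(b - 1) * measure M V \<le> (b - 1) * (measure M C / 2)" using 1 by simp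
  then have "measure M V \<le> measure M C / 2"
    using b by (subst (asm) mult_le_cancel_left_pos) auto
  then have "2 * measure M V \<le> measure M C" by simp
  then have "ennreal (2 * measure M V) \<le> ennreal (measure M C)" by (rule ennreal_leI)
  then show ?thesis unfolding V using mV mC(1) by (simp add: ennreal_mult)
qed

text \<open>A stopping cube contained in \<open>{h > c * t}\<close> is charged entirely to the last
  term. Any other one contains a point \<open>x\<close> with \<open>h x \<le> c * t\<close>, and
  this single point controls the oscillation over every cube containing \<open>C\<close>, in
  particular over its parent. Then the half-mass estimate applies to \<open>C\<close>.\<close>

lemma good_lambda:
  assumes g [measurable]: "g \<in> borel_measurable M"
    and fin: "(\<integral>\<^sup>+x. epow (g x) r \<partial>W) < \<infinity>"
    and \<kappa>: "case_prod \<kappa> \<in> borel_measurable (M \<Otimes>\<^sub>M M)"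
    and tri: "\<And>z y. g z \<le> \<kappa> z y + g y"
    and h [measurable]: "h \<in> borel_measurable M"
    and osc: "\<And>n P x. P \<in> D n \<Longrightarrow> x \<in> P \<Longrightarrow>
      (\<integral>\<^sup>+z\<in>P. (\<integral>\<^sup>+y\<in>P. \<kappa> z y \<partial>M) \<partial>M) \<le> h x * (emeasure M P)\<^sup>2"
    and t: "0 < t" and b: "1 < b"
  shows "emeasure W (level g (ennreal (b * t))) \<le> ennreal \<delta> * emeasure W (level g (ennreal t))
    + emeasure W {x \<in> space M. ennreal ((b - 1) / (2 * K) * t) < h x}"
proof -
  let ?S = "stopping g (ennreal t)" and ?L = "level g (ennreal (b * t))"
  define B where "B = {x \<in> space M. ennreal ((b - 1) / (2 * K) * t) < h x}"
  have hW [measurable]: "h \<in> borel_measurable W" by simp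
  have Bs: "B \<in> sets M" "B \<in> sets W" unfolding B_def by (measurable, simp add: sets_W)
  have LW: "?L \<in> sets W" "level g (ennreal t) \<in> sets W" using sets_W by auto
  have bt: "0 < b * t" using b t by simp
  have LL: "?L \<subseteq> \<Union>?S"
  proof -
    have "?L \<subseteq> level g (ennreal t)"
    proof -
      have "ennreal t * a \<le> ennreal (b * t) * a" for a
        using b t by (intro mult_right_mono ennreal_leI) auto
      then show ?thesis unfolding level_def by (auto intro: le_less_trans)
    qed
    then show ?thesis by (simp add: level_eq_Union_stopping[OF g t fin])
  qed
  have cube: "emeasure W (C \<inter> ?L) \<le> ennreal \<delta> * emeasure W C + emeasure W (C \<inter> B)"
    if C: "C \<in> ?S" for C
  proof (cases "C \<subseteq> B")
    case True
    moreover have "C \<in> sets W" using C stopping_sets[of g "ennreal t"] sets_W by blast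
    ultimately have "emeasure W (C \<inter> ?L) \<le> emeasure W (C \<inter> B)"
      using Bs(2) by (intro emeasure_mono sets.Int) auto
    then show ?thesis by (simp add: add_increasing)
  next
    case False
    obtain n where n: "C \<in> D n" using C unfolding stopping_def by blast
    obtain x where x: "x \<in> C" "x \<notin> B" using False by blast
    then have "x \<in> space M" using D_subset_space[OF n] by blast
    with x have hx: "h x \<le> ennreal ((b - 1) / (2 * K) * t)" by (simp add: B_def)
    have "2 * emeasure M (C \<inter> ?L) \<le> emeasure M C"
    proof (rule emeasure_level_in_stopping_cube[OF g fin \<kappa> tri t b C])
      fix m P assume P: "P \<in> D m" "C \<subseteq> P"
      have "(\<integral>\<^sup>+z\<in>P. (\<integral>\<^sup>+y\<in>P. \<kappa> z y \<partial>M) \<partial>M) \<le> h x * (emeasure M P)\<^sup>2"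
        using P x by (intro osc) auto
      also have "\<dots> \<le> ennreal ((b - 1) / (2 * K) * t) * (emeasure M P)\<^sup>2"
        by (intro mult_right_mono hx) auto
      finally show "(\<integral>\<^sup>+z\<in>P. (\<integral>\<^sup>+y\<in>P. \<kappa> z y \<partial>M) \<partial>M)
        \<le> ennreal ((b - 1) / (2 * K) * t) * (emeasure M P)\<^sup>2" .
    qed
    then have "emeasure W (C \<inter> ?L) \<le> ennreal \<delta> * emeasure W C"
      using D_sets[OF n] by (intro emeasure_W_small_subset[OF n]) auto
    then show ?thesis by (simp add: add_increasing2)
  qed
  have Ss: "C \<in> sets W" if "C \<in> ?S" for C
    using that stopping_sets[of g "ennreal t"] sets_W by auto
  have disj: "disjoint_family_on (\<lambda>C. C \<inter> X) ?S" for X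
    using disjoint_stopping[of g "ennreal t"] by (auto simp: disjoint_family_on_def disjoint_def)
  have sum: "emeasure W (X \<inter> \<Union>?S) = (\<integral>\<^sup>+C. emeasure W (C \<inter> X) \<partial>count_space ?S)"
    if "X \<in> sets W" for X
  proof -
    have "X \<inter> \<Union>?S = (\<Union>C\<in>?S. C \<inter> X)" by auto
    then show ?thesis
      using emeasure_UN_countable[OF sets.Int[OF Ss that] countable_stopping disj] by (simp only:)
  qed
  have "emeasure W ?L = (\<integral>\<^sup>+C. emeasure W (C \<inter> ?L) \<partial>count_space ?S)"
    using sum[OF LW(1)] LL by (simp add: Int_absorb2)
  also have "\<dots> \<le> (\<integral>\<^sup>+C. ennreal \<delta> * emeasure W C + emeasure W (C \<inter> B) \<partial>count_space ?S)"
    by (intro nn_integral_mono) (auto intro: cube)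
  also have "\<dots> = ennreal \<delta> * (\<integral>\<^sup>+C. emeasure W C \<partial>count_space ?S)
      + (\<integral>\<^sup>+C. emeasure W (C \<inter> B) \<partial>count_space ?S)"
    by (simp add: nn_integral_add nn_integral_cmult)
  also have "(\<integral>\<^sup>+C. emeasure W C \<partial>count_space ?S) = emeasure W (level g (ennreal t))"
  proof -
    have "(\<integral>\<^sup>+C. emeasure W C \<partial>count_space ?S)
        = (\<integral>\<^sup>+C. emeasure W (C \<inter> level g (ennreal t)) \<partial>count_space ?S)"
    proof (intro nn_integral_cong arg_cong[where f="emeasure W"])
      fix C assume "C \<in> space (count_space ?S)"
      then show "C = C \<inter> level g (ennreal t)"
        using Union_stopping_subset_level[of g "ennreal t"] by auto
    qed
    also have "\<dots> = emeasure W (level g (ennreal t) \<inter> \<Union>?S)" by (rule sum[OF LW(2), symmetric])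
    finally show ?thesis by (simp add: level_eq_Union_stopping[OF g t fin])
  qed
  also have "(\<integral>\<^sup>+C. emeasure W (C \<inter> B) \<partial>count_space ?S) \<le> emeasure W B"
    using sum[OF Bs(2)] Bs by (metis Int_lower1 emeasure_mono)
  finally show ?thesis by (simp add: B_def add_left_mono)
qed

end

section \<open>Summation over geometric levels\<close>

text \<open>The levels below \<open>y\<close> contribute a geometric sum, which is comparable to its
  largest term. The factor \<open>c powr (- r)\<close> comes from rescaling \<open>y\<close> by
  \<open>c\<close>.\<close>

lemma layer_cake_upper:
  fixes y :: ennreal and J :: "int set"
  assumes b: "1 < b" and r: "0 < r" and c: "0 < c" and J: "finite J"
  defines "\<beta> \<equiv> b powr r"
  shows "(\<Sum>j\<in>J. ennreal (\<beta> powr real_of_int j) * indicator {ennreal (c * b powr real_of_int j)<..} y)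
    \<le> ennreal (c powr (- r) * (\<beta> / (\<beta> - 1))) * epow y r"
proof -
  have \<beta>: "1 < \<beta>" using b r by (simp add: \<beta>_def)
  have pos: "0 < c powr (- r) * (\<beta> / (\<beta> - 1))" using c \<beta> by simp
  show ?thesis
  proof (cases y)
    case (real s)
    have iff: "c * b powr real_of_int j < s \<longleftrightarrow> \<beta> powr real_of_int j < (s / c) powr r" for j
    proof -
      have "c * b powr real_of_int j < s \<longleftrightarrow> b powr real_of_int j < s / c"
        using c by (simp add: field_simps)
      also have "\<dots> \<longleftrightarrow> (b powr real_of_int j) powr r < (s / c) powr r"
        using b r c real by (smt (verit) divide_nonneg_pos powr_less_mono2 powr_mono2 powr_ge_zero)
      finally show ?thesis by (simp add: \<beta>_def powr_powr mult.commute)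
    qed
    have "(\<Sum>j\<in>J. ennreal (\<beta> powr real_of_int j) * indicator {ennreal (c * b powr real_of_int j)<..} y)
        = (\<Sum>j\<in>{j\<in>J. \<beta> powr real_of_int j < (s / c) powr r}. ennreal (\<beta> powr real_of_int j))"
      using J real c by (intro sum.mono_neutral_cong_right) (auto simp: iff[symmetric] ennreal_less_iff split: split_indicator)
    also have "\<dots> = ennreal (\<Sum>j\<in>{j\<in>J. \<beta> powr real_of_int j < (s / c) powr r}. \<beta> powr real_of_int j)"
      by (simp add: sum_ennreal)
    also have "\<dots> \<le> ennreal ((s / c) powr r * (\<beta> / (\<beta> - 1)))"
      using sum_powr_less_le[OF J \<beta>, of "(s / c) powr r"] by (intro ennreal_leI) auto
    also have "(s / c) powr r * (\<beta> / (\<beta> - 1)) = c powr (- r) * (\<beta> / (\<beta> - 1)) * s powr r"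
      using real c by (simp add: powr_divide powr_minus field_simps)
    also have "ennreal \<dots> = ennreal (c powr (- r) * (\<beta> / (\<beta> - 1))) * epow y r"
      using pos real by (simp only: epow_ennreal ennreal_mult powr_ge_zero less_imp_le)
    finally show ?thesis .
  next
    case top
    have "ennreal q * top = top" if "0 < q" for q using that by (simp add: ennreal_mult_top)
    then show ?thesis using pos top by (simp only: epow_top top_greatest)
  qed
qed

text \<open>One term suffices: if \<open>s\<close> lies between \<open>b powr j\<close> and
  \<open>b powr (j + 1)\<close>, the coefficient with exponent \<open>j + 1\<close> already
  dominates. Symmetric finite sums make the right side an increasing limit, ready for monotone
  convergence.\<close>

lemma layer_cake_lower:
  assumes b: "1 < b" and r: "0 < r" and s: "0 \<le> s"
  defines "\<beta> \<equiv> b powr r"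
  shows "ennreal (s powr r) \<le> (SUP n. \<Sum>j\<in>{- int n..int n}. ennreal (\<beta> powr (real_of_int j + 1)) *
    indicator {ennreal (b powr real_of_int j)<..} (ennreal s))"
proof (cases "s = 0")
  case False
  then have s: "0 < s" using s by simp
  \<comment> \<open>The ceiling minus one makes the interval open below and closed above, as the
    strict inequality in the indicator demands.\<close>
  define j where "j = \<lceil>log b s\<rceil> - 1"
  have "real_of_int j < log b s" "log b s \<le> real_of_int j + 1"
    unfolding j_def by linarith+
  then have j: "b powr real_of_int j < s" "s \<le> b powr (real_of_int j + 1)"
    using b s by (auto simp: less_log_iff log_le_iff)
  have "s powr r \<le> (b powr (real_of_int j + 1)) powr r"
    using j s r by (intro powr_mono2) auto
  then have "s powr r \<le> \<beta> powr (real_of_int j + 1)"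
    by (simp add: \<beta>_def powr_powr mult.commute)
  then have "ennreal (s powr r) \<le> ennreal (\<beta> powr (real_of_int j + 1)) *
      indicator {ennreal (b powr real_of_int j)<..} (ennreal s)"
    using j s by (auto intro: ennreal_leI simp: ennreal_less_iff)
  also have "\<dots> \<le> (\<Sum>j\<in>{- int (nat \<bar>j\<bar>)..int (nat \<bar>j\<bar>)}. ennreal (\<beta> powr (real_of_int j + 1)) *
    indicator {ennreal (b powr real_of_int j)<..} (ennreal s))"
    by (rule member_le_sum) auto
  also have "\<dots> \<le> (SUP n. \<Sum>j\<in>{- int n..int n}. ennreal (\<beta> powr (real_of_int j + 1)) *
    indicator {ennreal (b powr real_of_int j)<..} (ennreal s))"
    by (rule SUP_upper) simp
  finally show ?thesis .
qed simp

text \<open>Defined outside the locale so that it visibly depends on \<open>K\<close>,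
  \<open>A\<close> and \<open>r\<close> alone. The factor
  \<open>1 / (1 - \<beta> * \<delta>)\<close> sums the contraction, the factor before it bounds the
  summed errors, and \<open>\<beta>\<^sup>2\<close> pays for two index shifts: rounding up to the
  next level, and comparing a superlevel set of \<open>g\<close> with the level set one step
  lower.\<close>

definition sharp_const :: "real \<Rightarrow> real \<Rightarrow> real \<Rightarrow> real"
  where "sharp_const K A r =
    (let \<delta> = 1 - (1 / 2) powr r / A; \<beta> = 1 / sqrt \<delta>; c = (\<beta> powr (1 / r) - 1) / (2 * K)
     in \<beta>\<^sup>2 * (\<beta> * (c powr (- r) * (\<beta> / (\<beta> - 1))) / (1 - \<beta> * \<delta>)))"

context weighted_dyadic_lattice
begin

text \<open>The contraction factor becomes \<open>\<beta> * \<delta> = sqrt \<delta> < 1\<close>,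
  while \<beta> itself exceeds 1 so that the levels grow; the ratio \<open>b\<close> is the one with
  \<open>b powr r = \<beta>\<close>.\<close>

definition \<beta> :: real where "\<beta> = 1 / sqrt \<delta>"
definition b :: real where "b = \<beta> powr (1 / r)"
definition c :: real where "c = (b - 1) / (2 * K)"

lemma \<beta>_gt_1: "1 < \<beta>" and \<beta>_\<delta>_less_1: "\<beta> * \<delta> < 1" and \<beta>_\<delta>_pos: "0 < \<beta> * \<delta>"
proof -
  have s: "0 < sqrt \<delta>" "sqrt \<delta> < 1" using \<delta>_pos \<delta>_less_1 by auto
  then show "1 < \<beta>" by (simp add: \<beta>_def)
  have "\<beta> * \<delta> = sqrt \<delta>" using \<delta>_pos by (simp add: \<beta>_def real_div_sqrt)
  then show "\<beta> * \<delta> < 1" "0 < \<beta> * \<delta>" using s by auto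
qed

lemma b_gt_1: "1 < b"
  using \<beta>_gt_1 r_pos powr_less_mono2[of "1 / r" 1 \<beta>] by (simp add: b_def)

lemma c_pos: "0 < c"
  using b_gt_1 K_pos by (simp add: c_def)

lemma b_powr_r: "b powr r = \<beta>"
  using r_pos \<beta>_gt_1 by (simp add: b_def powr_powr)

lemma sharp_const_eq:
  "sharp_const K A r = \<beta>\<^sup>2 * (\<beta> * (c powr (- r) * (\<beta> / (\<beta> - 1))) / (1 - \<beta> * \<delta>))"
  by (simp add: sharp_const_def Let_def c_def b_def \<beta>_def \<delta>_def)

lemma sharp_const_pos: "0 < sharp_const K A r"
  using \<beta>_gt_1 \<beta>_\<delta>_less_1 c_pos unfolding sharp_const_eq
  by (intro mult_pos_pos divide_pos_pos) auto

theorem sharp_bound: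
  assumes g [measurable]: "g \<in> borel_measurable M" and g_nonneg: "\<And>x. 0 \<le> g x"
    and fin: "(\<integral>\<^sup>+x. ennreal (g x powr r) \<partial>W) < \<infinity>"
    and \<kappa>: "case_prod \<kappa> \<in> borel_measurable (M \<Otimes>\<^sub>M M)"
    and tri: "\<And>z y. ennreal (g z) \<le> \<kappa> z y + ennreal (g y)"
    and h [measurable]: "h \<in> borel_measurable M"
    and osc: "\<And>n P x. P \<in> D n \<Longrightarrow> x \<in> P \<Longrightarrow>
      (\<integral>\<^sup>+z\<in>P. (\<integral>\<^sup>+y\<in>P. \<kappa> z y \<partial>M) \<partial>M) \<le> h x * (emeasure M P)\<^sup>2"
  shows "(\<integral>\<^sup>+x. ennreal (g x powr r) \<partial>W)
    \<le> ennreal (sharp_const K A r) * (\<integral>\<^sup>+x. epow (h x) r \<partial>W)"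
proof (cases "(\<integral>\<^sup>+x. epow (h x) r \<partial>W) = \<infinity>")
  case True
  then show ?thesis using sharp_const_pos by (simp add: ennreal_mult_top)
next
  case False
  then obtain H where H: "(\<integral>\<^sup>+x. epow (h x) r \<partial>W) = ennreal H" "0 \<le> H"
    by (cases "\<integral>\<^sup>+x. epow (h x) r \<partial>W") auto
  have [measurable]: "g \<in> borel_measurable W" "h \<in> borel_measurable W" by auto
  define G where "G x = ennreal (g x)" for x
  have G [measurable]: "G \<in> borel_measurable M" "G \<in> borel_measurable W"
    unfolding G_def by measurable
  have Gr: "epow (G x) r = ennreal (g x powr r)" for x
    by (simp add: G_def epow_ennreal g_nonneg)
  have finG: "(\<integral>\<^sup>+x. epow (G x) r \<partial>W) < \<infinity>" using fin by (simp add: Gr)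
  obtain B where B: "(\<integral>\<^sup>+x. epow (G x) r \<partial>W) = ennreal B" "0 \<le> B"
    using finG by (cases "\<integral>\<^sup>+x. epow (G x) r \<partial>W") auto
  have bj: "0 < b powr real_of_int j" for j using b_gt_1 by simp
  have bjr: "(b powr real_of_int j) powr r = \<beta> powr real_of_int j" for j
    by (simp add: powr_powr mult.commute flip: b_powr_r)
  define w where "w j = measure W (level G (ennreal (b powr real_of_int j)))" for j :: int
  have weak: "ennreal (\<beta> powr real_of_int j) * emeasure W (level G (ennreal (b powr real_of_int j)))
      \<le> ennreal (A * B)" for j
    using weak_type[OF G(1) bj finG, of j] B A_ge by (simp add: bjr ennreal_mult)
  have \<beta>j: "0 < \<beta> powr real_of_int j" for j using \<beta>_gt_1 by simp
  have w: "emeasure W (level G (ennreal (b powr real_of_int j))) = ennreal (w j)" for j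
  proof -
    have "emeasure W (level G (ennreal (b powr real_of_int j))) \<noteq> \<infinity>"
    proof
      assume "emeasure W (level G (ennreal (b powr real_of_int j))) = \<infinity>"
      then show False using weak[of j] \<beta>j[of j] by (simp add: ennreal_mult_top top_unique)
    qed
    then show ?thesis unfolding w_def by (intro emeasure_eq_ennreal_measure) simp
  qed
  have w_nonneg [simp]: "0 \<le> w j" for j by (simp add: w_def)
  define S where "S j = \<beta> powr real_of_int j * w j" for j
  have S_le: "S j \<le> A * B" for j
  proof -
    have "ennreal (S j) \<le> ennreal (A * B)"
      using weak[of j] by (simp add: w S_def ennreal_mult'')
    then show ?thesis using A_ge B by (simp add: ennreal_le_iff)
  qed
  define E where "E j = {x \<in> space M. ennreal (c * b powr real_of_int j) < h x}" for j :: int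
  have E [measurable]: "E j \<in> sets W" for j
  proof -
    have "E j \<in> sets M" unfolding E_def by measurable
    then show ?thesis by (simp add: sets_W)
  qed
  have E_sum: "(\<Sum>j\<in>J. ennreal (\<beta> powr real_of_int j) * emeasure W (E j))
      \<le> ennreal (c powr (- r) * (\<beta> / (\<beta> - 1)) * H)" if J: "finite J" for J
  proof -
    have "(\<Sum>j\<in>J. ennreal (\<beta> powr real_of_int j) * emeasure W (E j))
        = (\<integral>\<^sup>+x. (\<Sum>j\<in>J. ennreal (\<beta> powr real_of_int j) * indicator (E j) x) \<partial>W)"
      by (subst nn_integral_sum)
        (intro borel_measurable_times_ennreal borel_measurable_const borel_measurable_indicator E,
          simp only: nn_integral_cmult_indicator[OF E])
    also have "\<dots> = (\<integral>\<^sup>+x. (\<Sum>j\<in>J. ennreal (\<beta> powr real_of_int j) *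
        indicator {ennreal (c * b powr real_of_int j)<..} (h x)) \<partial>W)"
      by (intro nn_integral_cong sum.cong) (auto simp: E_def space_W split: split_indicator)
    also have "\<dots> \<le> (\<integral>\<^sup>+x. ennreal (c powr (- r) * (\<beta> / (\<beta> - 1))) * epow (h x) r \<partial>W)"
      using layer_cake_upper[OF b_gt_1 r_pos c_pos J] by (intro nn_integral_mono) (simp add: b_powr_r)
    also have "\<dots> = ennreal (c powr (- r) * (\<beta> / (\<beta> - 1)) * H)"
      unfolding ennreal_mult''[OF H(2)] H(1)[symmetric] by (intro nn_integral_cmult) measurable
    finally show ?thesis .
  qed
  define v where "v j = measure W (E j)" for j
  have v_nonneg [simp]: "0 \<le> v j" for j by (simp add: v_def)
  have v: "emeasure W (E j) = ennreal (v j)" for j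
  proof -
    have "emeasure W (E j) \<noteq> \<infinity>"
    proof
      assume "emeasure W (E j) = \<infinity>"
      then show False using E_sum[of "{j}"] \<beta>j[of j] by (simp add: ennreal_mult_top top_unique)
    qed
    then show ?thesis unfolding v_def by (intro emeasure_eq_ennreal_measure) simp
  qed
  \<comment> \<open>The error of step \<open>j - 1\<close> is multiplied by the power of \<beta>
    that belongs to \<open>j\<close>, hence the extra factor \<beta>.\<close>
  define T where "T j = \<beta> * (\<beta> powr real_of_int j * v j)" for j
  define \<tau> where "\<tau> = \<beta> * (c powr (- r) * (\<beta> / (\<beta> - 1))) * H"
  have T: "sum T J \<le> \<tau>" if J: "finite J" for J
  proof -
    have "ennreal (\<Sum>j\<in>J. \<beta> powr real_of_int j * v j) \<le> ennreal (c powr (- r) * (\<beta> / (\<beta> - 1)) * H)"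
      using E_sum[OF J] by (simp add: v ennreal_mult[symmetric] sum_ennreal)
    then have "(\<Sum>j\<in>J. \<beta> powr real_of_int j * v j) \<le> c powr (- r) * (\<beta> / (\<beta> - 1)) * H"
      using H \<beta>_gt_1 by (subst (asm) ennreal_le_iff) auto
    then have "\<beta> * (\<Sum>j\<in>J. \<beta> powr real_of_int j * v j) \<le> \<beta> * (c powr (- r) * (\<beta> / (\<beta> - 1)) * H)"
      using \<beta>_gt_1 by (intro mult_left_mono) auto
    then show ?thesis by (simp add: T_def \<tau>_def sum_distrib_left mult.assoc)
  qed
  \<comment> \<open>This is \<open>good_lambda\<close> at height \<open>t = b powr (j - 1)\<close>,
    multiplied by \<open>\<beta> powr j\<close>.\<close>
  have rec: "S j \<le> \<beta> * \<delta> * S (j - 1) + T (j - 1)" for j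
  proof -
    have eq: "b * b powr real_of_int (j - 1) = b powr real_of_int j"
      "\<beta> * \<beta> powr real_of_int (j - 1) = \<beta> powr real_of_int j"
      using b_gt_1 \<beta>_gt_1 by (simp_all add: powr_diff)
    have "emeasure W (level G (ennreal (b * b powr real_of_int (j - 1))))
        \<le> ennreal \<delta> * emeasure W (level G (ennreal (b powr real_of_int (j - 1)))) + emeasure W (E (j - 1))"
      unfolding E_def c_def
      by (rule good_lambda[OF G(1) finG \<kappa> _ h osc bj b_gt_1]) (auto simp: G_def tri)
    then have "ennreal (w j) \<le> ennreal \<delta> * ennreal (w (j - 1)) + ennreal (v (j - 1))"
      by (simp only: eq w v)
    then have "w j \<le> \<delta> * w (j - 1) + v (j - 1)"
      using \<delta>_pos by (simp add: ennreal_mult[symmetric] ennreal_plus[symmetric] del: ennreal_plus)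
    then have "\<beta> powr real_of_int j * w j \<le> \<beta> powr real_of_int j * (\<delta> * w (j - 1) + v (j - 1))"
      by (intro mult_left_mono) auto
    also have "\<dots> = \<beta> * \<delta> * S (j - 1) + T (j - 1)"
      by (simp add: S_def T_def algebra_simps flip: eq(2))
    finally show ?thesis by (simp only: S_def)
  qed
  have S_sum: "sum S J \<le> \<tau> / (1 - \<beta> * \<delta>)" if "finite J" for J
    using \<beta>_\<delta>_pos \<beta>_\<delta>_less_1 that
    by (intro sum_le_of_contraction[OF _ _ S_le rec T]) auto
  define U where "U j = {x \<in> space M. ennreal (b powr real_of_int j) < G x}" for j :: int
  have U [measurable]: "U j \<in> sets W" for j
  proof -
    have "U j \<in> sets M" unfolding U_def by measurable
    then show ?thesis by (simp add: sets_W)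
  qed
  \<comment> \<open>The differentiation theorem needs two distinct heights, so the superlevel set of
    index \<open>j\<close> is compared with the level set of index \<open>j - 1\<close>. Null sets
    of \<open>M\<close> are null for \<open>W\<close>.\<close>
  have U_le: "emeasure W (U j) \<le> ennreal (w (j - 1))" for j
  proof -
    let ?L = "level G (ennreal (b powr real_of_int (j - 1)))"
    have lt: "b powr real_of_int (j - 1) < b powr real_of_int j"
      using b_gt_1 by (intro powr_less_mono) auto
    have "U j - ?L \<in> null_sets W"
      unfolding U_def by (intro W_null superlevel_minus_level_null G lt less_imp_le[OF bj])
    moreover have LW: "?L \<in> sets W" by (simp add: sets_W level_sets)
    ultimately have "emeasure W (?L \<union> (U j - ?L)) = emeasure W ?L"
      by (intro emeasure_Un_null_set)
    moreover have "emeasure W (U j) \<le> emeasure W (?L \<union> (U j - ?L))"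
      using U[of j] LW by (intro emeasure_mono sets.Un sets.Diff) auto
    ultimately show ?thesis by (simp only: w)
  qed
  let ?c = "\<lambda>j. ennreal (\<beta> powr (real_of_int j + 1))"
  have "(\<integral>\<^sup>+x. ennreal (g x powr r) \<partial>W)
      \<le> (\<integral>\<^sup>+x. (SUP n. \<Sum>j\<in>{- int n..int n}. ?c j * indicator (U j) x) \<partial>W)"
  proof (intro nn_integral_mono)
    fix x assume "x \<in> space W"
    then have "indicator {ennreal (b powr real_of_int j)<..} (ennreal (g x)) = (indicator (U j) x :: ennreal)" for j
      by (auto simp: U_def G_def space_W split: split_indicator)
    then show "ennreal (g x powr r) \<le> (SUP n. \<Sum>j\<in>{- int n..int n}. ?c j * indicator (U j) x)"
      using layer_cake_lower[OF b_gt_1 r_pos g_nonneg[of x]] by (simp add: b_powr_r)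
  qed
  also have "\<dots> = (SUP n. \<integral>\<^sup>+x. (\<Sum>j\<in>{- int n..int n}. ?c j * indicator (U j) x) \<partial>W)"
  proof (rule nn_integral_monotone_convergence_SUP)
    show "incseq (\<lambda>n x. \<Sum>j\<in>{- int n..int n}. ?c j * indicator (U j) x)"
      by (intro incseq_SucI le_funI sum_mono2) auto
    show "(\<lambda>x. \<Sum>j\<in>{- int n..int n}. ?c j * indicator (U j) x) \<in> borel_measurable W" for n
      by (intro borel_measurable_sum borel_measurable_times_ennreal borel_measurable_const
          borel_measurable_indicator U)
  qed
  also have "\<dots> \<le> ennreal (sharp_const K A r * H)"
  proof (intro SUP_least)
    fix n :: nat
    let ?J = "{- int n..int n}"
    have inj: "inj_on (\<lambda>j::int. j - 1) ?J" by (auto simp: inj_on_def)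
    have "(\<integral>\<^sup>+x. (\<Sum>j\<in>?J. ?c j * indicator (U j) x) \<partial>W) = (\<Sum>j\<in>?J. ?c j * emeasure W (U j))"
      by (subst nn_integral_sum)
        (intro borel_measurable_times_ennreal borel_measurable_const borel_measurable_indicator U,
          simp only: nn_integral_cmult_indicator[OF U])
    also have "\<dots> \<le> (\<Sum>j\<in>?J. ?c j * ennreal (w (j - 1)))"
      by (intro sum_mono mult_left_mono U_le) auto
    also have "\<dots> = (\<Sum>j\<in>?J. ennreal (\<beta>\<^sup>2 * S (j - 1)))"
    proof (intro sum.cong refl)
      fix j
      have "\<beta> powr (real_of_int j + 1) = \<beta>\<^sup>2 * \<beta> powr real_of_int (j - 1)"
        using \<beta>_gt_1 by (simp add: powr_diff powr_add power2_eq_square)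
      then show "?c j * ennreal (w (j - 1)) = ennreal (\<beta>\<^sup>2 * S (j - 1))"
        by (simp add: S_def mult.assoc flip: ennreal_mult)
    qed
    also have "\<dots> = ennreal (\<beta>\<^sup>2 * sum S ((\<lambda>j. j - 1) ` ?J))"
    proof -
      have "\<beta>\<^sup>2 * sum S ((\<lambda>j. j - 1) ` ?J) = (\<Sum>j\<in>?J. \<beta>\<^sup>2 * S (j - 1))"
        unfolding sum.reindex[OF inj] o_def by (rule sum_distrib_left)
      then show ?thesis by (subst sum_ennreal) (auto simp: S_def)
    qed
    also have "\<dots> \<le> ennreal (\<beta>\<^sup>2 * (\<tau> / (1 - \<beta> * \<delta>)))"
      by (intro ennreal_leI mult_left_mono S_sum) auto
    also have "\<beta>\<^sup>2 * (\<tau> / (1 - \<beta> * \<delta>)) = sharp_const K A r * H"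
      by (simp add: sharp_const_eq \<tau>_def)
    finally show "(\<integral>\<^sup>+x. (\<Sum>j\<in>?J. ?c j * indicator (U j) x) \<partial>W) \<le> ennreal (sharp_const K A r * H)" .
  qed
  also have "\<dots> = ennreal (sharp_const K A r) * (\<integral>\<^sup>+x. epow (h x) r \<partial>W)"
    using H sharp_const_pos by (simp add: ennreal_mult)
  finally show ?thesis .
qed

end

subsection \<open>The $A_p$ condition on a cube\<close>

text \<open>A fraction in [0, 1] does not exceed its \<gamma>-th power; this is applied to the
  shares of \<open>a\<close> and \<open>b\<close> in \<open>a + b\<close>.\<close>

lemma powr_add_le:
  fixes a b \<gamma> :: real
  assumes "0 \<le> a" "0 \<le> b" "0 < \<gamma>" "\<gamma> \<le> 1"
  shows "(a + b) powr \<gamma> \<le> a powr \<gamma> + b powr \<gamma>"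
proof (cases "a + b = 0")
  case False
  then have ab: "0 < a + b" using assms by simp
  have *: "c / (a + b) * (a + b) powr \<gamma> \<le> c powr \<gamma>" if c: "0 \<le> c" "c \<le> a + b" for c
  proof -
    have "c / (a + b) = (c / (a + b)) powr 1" using c ab by simp
    also have "\<dots> \<le> (c / (a + b)) powr \<gamma>"
      using c ab assms by (intro powr_mono') auto
    finally have "c / (a + b) * (a + b) powr \<gamma> \<le> (c / (a + b)) powr \<gamma> * (a + b) powr \<gamma>"
      by (intro mult_right_mono) auto
    also have "\<dots> = c powr \<gamma>" using c ab by (simp add: powr_divide)
    finally show ?thesis .
  qed
  have "(a + b) powr \<gamma> = a / (a + b) * (a + b) powr \<gamma> + b / (a + b) * (a + b) powr \<gamma>"
    using ab by (simp add: distrib_right[symmetric] add_divide_distrib[symmetric])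
  then show ?thesis using *[of a] *[of b] assms by simp
qed (use assms in auto)

text \<open>Hoelder's inequality, obtained from Jensen's inequality for \<open>h / \<sigma>\<close>
  with respect to the measure with density \<sigma> on \<open>C\<close>, where \<sigma> is the dual
  weight. Wherever \<open>w\<close> is positive and finite, the power of \<sigma> with exponent
  \<open>1 - p\<close> equals \<open>w\<close>, which turns the right side into an integral against
  the weight.\<close>

lemma set_integral_holder_weight:
  assumes [measurable]: "C \<in> sets M" "w \<in> borel_measurable M" "h \<in> borel_measurable M"
    and w: "AE x in M. 0 < w x \<and> w x < \<infinity>" and p: "1 < p"
    and fin: "(\<integral>\<^sup>+x\<in>C. epow (inverse (w x)) (1 / (p - 1)) \<partial>M) < \<infinity>"
  shows "epow (\<integral>\<^sup>+x\<in>C. h x \<partial>M) p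
    \<le> epow (\<integral>\<^sup>+x\<in>C. epow (inverse (w x)) (1 / (p - 1)) \<partial>M) (p - 1) * (\<integral>\<^sup>+x\<in>C. epow (h x) p \<partial>density M w)"
proof -
  define \<sigma> where "\<sigma> x = epow (inverse (w x)) (1 / (p - 1))" for x
  have [measurable]: "\<sigma> \<in> borel_measurable M" unfolding \<sigma>_def by measurable
  define \<nu> where "\<nu> = density M (\<lambda>x. \<sigma> x * indicator C x)"
  have \<nu>: "(\<integral>\<^sup>+x. u x \<partial>\<nu>) = (\<integral>\<^sup>+x. \<sigma> x * indicator C x * u x \<partial>M)" if "u \<in> borel_measurable M" for u
    unfolding \<nu>_def using that by (intro nn_integral_density) auto
  have [measurable]: "u \<in> borel_measurable \<nu>" if "u \<in> borel_measurable M" for u :: "_ \<Rightarrow> ennreal"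
    using that by (simp add: \<nu>_def)
  have total: "emeasure \<nu> (space \<nu>) = (\<integral>\<^sup>+x\<in>C. \<sigma> x \<partial>M)"
    using \<nu>[of "\<lambda>_. 1"] by simp
  have pt: "\<sigma> x * (h x / \<sigma> x) = h x \<and> \<sigma> x * epow (h x / \<sigma> x) p = w x * epow (h x) p"
    if wx: "0 < w x" "w x < \<infinity>" for x
  proof -
    obtain u where u: "w x = ennreal u" "0 < u" using wx by (cases "w x") auto
    define s where "s = (1 / u) powr (1 / (p - 1))"
    have s: "0 < s" "\<sigma> x = ennreal s"
      using u by (auto simp: s_def \<sigma>_def inverse_ennreal epow_ennreal inverse_eq_divide)
    have "s powr (p - 1) = 1 / u"
      using u p by (simp add: s_def powr_powr)
    then have us: "u * s powr p = s"
      using s u p by (simp add: powr_diff field_simps)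
    show ?thesis
    proof (cases "h x")
      case (real y)
      have "s * (y / s) powr p = u * y powr p"
      proof -
        have "s * (y / s) powr p = (u * s powr p) * (y / s) powr p" by (simp add: us)
        also have "\<dots> = u * y powr p" using s real by (simp add: powr_divide)
        finally show ?thesis .
      qed
      then show ?thesis
        using real s u by (simp add: divide_ennreal ennreal_mult[symmetric] epow_ennreal)
    next
      case top
      then show ?thesis using s u by (simp add: ennreal_top_divide ennreal_mult_top)
    qed
  qed
  have "epow (\<integral>\<^sup>+x. h x / \<sigma> x \<partial>\<nu>) p
      \<le> epow (emeasure \<nu> (space \<nu>)) (p - 1) * (\<integral>\<^sup>+x. epow (h x / \<sigma> x) p \<partial>\<nu>)"
    using fin p by (intro nn_integral_Jensen) (auto simp: total \<sigma>_def)
  also have "(\<integral>\<^sup>+x. h x / \<sigma> x \<partial>\<nu>) = (\<integral>\<^sup>+x\<in>C. h x \<partial>M)"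
  proof -
    have "(\<integral>\<^sup>+x. h x / \<sigma> x \<partial>\<nu>) = (\<integral>\<^sup>+x. \<sigma> x * indicator C x * (h x / \<sigma> x) \<partial>M)"
      by (rule \<nu>) measurable
    also have "\<dots> = (\<integral>\<^sup>+x\<in>C. h x \<partial>M)"
      by (intro nn_integral_cong_AE, use w in eventually_elim) (use pt in \<open>auto split: split_indicator\<close>)
    finally show ?thesis .
  qed
  also have "(\<integral>\<^sup>+x. epow (h x / \<sigma> x) p \<partial>\<nu>) = (\<integral>\<^sup>+x\<in>C. epow (h x) p \<partial>density M w)"
  proof -
    have "(\<integral>\<^sup>+x. epow (h x / \<sigma> x) p \<partial>\<nu>) = (\<integral>\<^sup>+x. \<sigma> x * indicator C x * epow (h x / \<sigma> x) p \<partial>M)"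
      by (rule \<nu>) measurable
    also have "\<dots> = (\<integral>\<^sup>+x. w x * (epow (h x) p * indicator C x) \<partial>M)"
      by (intro nn_integral_cong_AE, use w in eventually_elim) (use pt in \<open>auto split: split_indicator\<close>)
    also have "\<dots> = (\<integral>\<^sup>+x\<in>C. epow (h x) p \<partial>density M w)"
      by (intro nn_integral_density[symmetric]) auto
    finally show ?thesis .
  qed
  finally show ?thesis by (simp only: total \<sigma>_def)
qed

text \<open>The factor \<open>\<theta>\<close> amounts to the inclusion $A_p \subseteq A_{\theta p}$.\<close>

lemma muckenhoupt_condition:
  assumes [measurable]: "C \<in> sets M" "w \<in> borel_measurable M" "h \<in> borel_measurable M"
    and w: "AE x in M. 0 < w x \<and> w x < \<infinity>" and p: "1 < p" and \<theta>: "1 \<le> \<theta>"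
    and C: "emeasure M C < \<infinity>" and W: "0 < emeasure (density M w) C" "emeasure (density M w) C < \<infinity>"
    and A: "0 \<le> A"
    and Ap: "(\<integral>\<^sup>+x\<in>C. w x \<partial>M) * epow (\<integral>\<^sup>+x\<in>C. epow (inverse (w x)) (1 / (p - 1)) \<partial>M) (p - 1)
      \<le> ennreal A * epow (emeasure M C) p"
  shows "epow (\<integral>\<^sup>+x\<in>C. h x \<partial>M) (p * \<theta>) * emeasure (density M w) C
    \<le> ennreal (A powr \<theta>) * epow (emeasure M C) (p * \<theta>) * (\<integral>\<^sup>+x\<in>C. epow (h x) (p * \<theta>) \<partial>density M w)"
proof -
  let ?W = "emeasure (density M w) C" and ?S = "\<integral>\<^sup>+x\<in>C. epow (inverse (w x)) (1 / (p - 1)) \<partial>M"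
  let ?X = "\<integral>\<^sup>+x\<in>C. h x \<partial>M" and ?m = "emeasure M C"
  let ?Y = "\<integral>\<^sup>+x\<in>C. epow (h x) p \<partial>density M w" and ?Z = "\<integral>\<^sup>+x\<in>C. epow (h x) (p * \<theta>) \<partial>density M w"
  have W_eq: "?W = (\<integral>\<^sup>+x\<in>C. w x \<partial>M)" by (simp add: emeasure_density)
  obtain u where u: "?W = ennreal u" "0 < u" using W by (cases ?W) auto
  \<comment> \<open>Since the weight of \<open>C\<close> is positive, an infinite dual integral
    would make the left side of \<open>Ap\<close> infinite, while its right side is finite.\<close>
  have "?S < \<infinity>"
  proof (rule ccontr)
    assume "\<not> ?thesis"
    then have "?S = top" by (simp add: less_top[symmetric])
    then have "top \<le> ennreal A * epow ?m p"
      using Ap u unfolding W_eq[symmetric] by (simp add: ennreal_mult_top)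
    moreover have "ennreal A * epow ?m p < top" using C by (simp add: ennreal_mult_less_top)
    ultimately show False by simp
  qed
  then have "epow ?X p \<le> epow ?S (p - 1) * ?Y"
    by (intro set_integral_holder_weight w p) auto
  then have "epow ?X p * ?W \<le> epow ?S (p - 1) * ?Y * ?W" by (rule mult_right_mono) simp
  also have "\<dots> = ?W * epow ?S (p - 1) * ?Y" by (simp add: mult_ac)
  also have "\<dots> \<le> ennreal A * epow ?m p * ?Y"
    using Ap unfolding W_eq[symmetric] by (rule mult_right_mono) simp
  finally have "epow (epow ?X p * ?W) \<theta> \<le> epow (ennreal A * epow ?m p * ?Y) \<theta>"
    using \<theta> by (intro epow_mono) auto
  then have "epow ?X (p * \<theta>) * epow ?W \<theta> \<le> ennreal (A powr \<theta>) * epow ?m (p * \<theta>) * epow ?Y \<theta>"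
    using A by (simp add: epow_mult epow_epow epow_ennreal)
  \<comment> \<open>Jensen's inequality on \<open>C\<close> with respect to the weighted measure
    raises the exponent from \<open>p\<close> to \<open>p * \<theta>\<close>. The surplus power
    \<open>\<theta> - 1\<close> of the weight of \<open>C\<close> cancels against the left
    side.\<close>
  also have "epow ?Y \<theta> \<le> epow ?W (\<theta> - 1) * ?Z"
  proof -
    define \<nu> where "\<nu> = density (density M w) (indicator C)"
    have \<nu>: "(\<integral>\<^sup>+x. f x \<partial>\<nu>) = (\<integral>\<^sup>+x\<in>C. f x \<partial>density M w)" if "f \<in> borel_measurable M" for f
      unfolding \<nu>_def using that by (subst nn_integral_density) (auto simp: mult.commute)
    have total: "emeasure \<nu> (space \<nu>) = ?W"
      using \<nu>[of "\<lambda>_. 1"] by simp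
    have "epow (\<integral>\<^sup>+x. epow (h x) p \<partial>\<nu>) \<theta>
        \<le> epow (emeasure \<nu> (space \<nu>)) (\<theta> - 1) * (\<integral>\<^sup>+x. epow (epow (h x) p) \<theta> \<partial>\<nu>)"
      using \<theta> W by (intro nn_integral_Jensen) (auto simp: total \<nu>_def[symmetric], simp add: \<nu>_def)
    then show ?thesis by (simp add: \<nu> total epow_epow)
  qed
  finally have "epow ?X (p * \<theta>) * epow ?W \<theta>
      \<le> ennreal (A powr \<theta>) * epow ?m (p * \<theta>) * (epow ?W (\<theta> - 1) * ?Z)"
    by (simp add: mult_left_mono)
  moreover have "epow ?W \<theta> = ?W * epow ?W (\<theta> - 1)"
    using epow_add[of ?W 1 "\<theta> - 1"] by simp
  ultimately have "epow ?W (\<theta> - 1) * (epow ?X (p * \<theta>) * ?W)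
      \<le> epow ?W (\<theta> - 1) * (ennreal (A powr \<theta>) * epow ?m (p * \<theta>) * ?Z)"
    by (simp add: mult_ac)
  then show ?thesis
    using u by (subst (asm) ennreal_mult_le_mult_iff) (auto simp: epow_ennreal)
qed

subsection \<open>Anisotropic dyadic cubes\<close>

context dyadic_setting
begin

lemma space_M: "space M = Omega d I"
proof -
  have "space M = space (restrict_space (PiM {..<d} (\<lambda>_. borel)) (Omega d I))"
    by (rule sets_eq_imp_space_eq[OF sets_M])
  also have "\<dots> = Omega d I"
    unfolding space_restrict_space space_PiM Omega_def by (intro Int_absorb2 PiE_mono) simp
  finally show ?thesis .
qed

lemma Omega_Int_sets: "B \<in> sets (PiM {..<d} (\<lambda>_. borel)) \<Longrightarrow> Omega d I \<inter> B \<in> sets M"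
  unfolding sets_M sets_restrict_space by (rule imageI)

lemma Omega_Int_box_sets:
  assumes "\<And>j. j < d \<Longrightarrow> X j \<in> sets borel"
  shows "Omega d I \<inter> PiE {..<d} X \<in> sets M"
proof (rule Omega_Int_sets)
  show "PiE {..<d} X \<in> sets (PiM {..<d} (\<lambda>_. borel))"
    by (rule sets_PiM_I_finite) (use assms in simp_all)
qed

lemma box_sets:
  assumes "\<And>j. j < d \<Longrightarrow> X j \<in> sets borel" "PiE {..<d} X \<subseteq> Omega d I"
  shows "PiE {..<d} X \<in> sets M"
  using Omega_Int_box_sets[of X, OF assms(1)] unfolding Int_absorb1[OF assms(2)] .

lemma interval_upward:
  assumes "j < d" "a \<in> I j" "a \<le> b"
  shows "b \<in> I j"
  using intervals[OF assms(1)] assms(2,3) by (elim disjE exE) simp_all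

definition side :: "int \<Rightarrow> nat \<Rightarrow> real"
  where "side n j = 2 powi (- (int (k j) * n))"

lemma side_pos [simp]: "0 < side n j"
  by (simp add: side_def)

lemma side_nonneg [simp]: "0 \<le> side n j"
  by (simp add: side_def)

lemma side_eq: "side n j = (2 powi (- n)) ^ k j"
proof -
  have "side n j = 2 powi (- n * int (k j))" by (simp add: side_def mult.commute)
  then show ?thesis unfolding power_int_mult by simp
qed

lemma side_refine:
  assumes "m \<le> n"
  shows "side m j = 2 ^ (k j * nat (n - m)) * side n j"
proof -
  have "side m j = 2 powi (int (k j * nat (n - m)) + - (int (k j) * n))"
    using assms by (simp add: side_def algebra_simps)
  also have "\<dots> = 2 powi int (k j * nat (n - m)) * 2 powi (- (int (k j) * n))"
    by (rule power_int_add) simp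
  finally show ?thesis by (simp only: side_def power_int_of_nat)
qed

lemma dyadic_cubesE:
  assumes "C \<in> dyadic_cubes d k I n"
  obtains i where "C = PiE {..<d} (\<lambda>j. {of_int (i j) * side n j ..< (of_int (i j) + 1) * side n j})"
    "C \<subseteq> Omega d I"
  using assms that unfolding dyadic_cubes_def side_def mem_Collect_eq by (elim conjE exE)

lemma dyadic_cube_width:
  assumes "C \<in> dyadic_cubes d k I n" "x \<in> C" "y \<in> C" "j < d"
  shows "\<bar>x j - y j\<bar> < side n j"
proof -
  obtain i where i: "C = PiE {..<d} (\<lambda>j. {of_int (i j) * side n j ..< (of_int (i j) + 1) * side n j})"
    by (rule dyadic_cubesE[OF assms(1)])
  have "x j \<in> {of_int (i j) * side n j ..< (of_int (i j) + 1) * side n j}"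
    "y j \<in> {of_int (i j) * side n j ..< (of_int (i j) + 1) * side n j}"
    using PiE_mem[OF assms(2)[unfolded i], of j] PiE_mem[OF assms(3)[unfolded i], of j] assms(4)
    by simp_all
  then show ?thesis by (simp add: abs_less_iff distrib_right)
qed

lemma dyadic_cube_sets: "C \<in> dyadic_cubes d k I n \<Longrightarrow> C \<in> sets M"
proof (erule dyadic_cubesE)
  fix i
  assume sub: "C \<subseteq> Omega d I"
    and C: "C = PiE {..<d} (\<lambda>j. {of_int (i j) * side n j ..< (of_int (i j) + 1) * side n j})"
  show "C \<in> sets M"
    unfolding C by (rule box_sets) (use sub C in simp_all)
qed

lemma countable_dyadic_cubes: "countable (dyadic_cubes d k I n)"
proof -
  let ?c = "\<lambda>i. PiE {..<d} (\<lambda>j. {of_int (i j) * side n j ..< (of_int (i j) + 1) * side n j})"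
  have "dyadic_cubes d k I n \<subseteq> ?c ` (PiE {..<d} (\<lambda>_. UNIV :: int set))"
  proof
    fix C assume "C \<in> dyadic_cubes d k I n"
    then obtain i where i: "C = ?c i" by (rule dyadic_cubesE)
    have "C = ?c (restrict i {..<d})" unfolding i by (rule PiE_cong) simp
    moreover have "restrict i {..<d} \<in> PiE {..<d} (\<lambda>_. UNIV)" by simp
    ultimately show "C \<in> ?c ` (PiE {..<d} (\<lambda>_. UNIV))" by (rule image_eqI)
  qed
  then show ?thesis
    by (rule countable_subset) (intro countable_image countable_PiE, auto)
qed

text \<open>A common point gives strict inequalities between endpoints that are integer multiples of
  \<open>s'\<close>. Between integers these improve by one, which is the inclusion.\<close>

lemma dyadic_interval_nested:
  fixes i i' :: int and s s' :: real
  assumes s: "0 < s'" "s = of_int q * s'"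
    and x: "x \<in> {of_int i * s ..< (of_int i + 1) * s}" "x \<in> {of_int i' * s' ..< (of_int i' + 1) * s'}"
  shows "{of_int i' * s' ..< (of_int i' + 1) * s'} \<subseteq> {of_int i * s ..< (of_int i + 1) * s}"
proof -
  have "of_int (i * q) * s' < of_int (i' + 1) * s'" "of_int i' * s' < of_int ((i + 1) * q) * s'"
    using x unfolding s(2) by (simp_all add: mult.assoc)
  then have "i * q < i' + 1" "i' < (i + 1) * q"
    using s(1) by (simp_all only: mult_less_cancel_right_pos of_int_less_iff)
  then have "i * q \<le> i'" "i' + 1 \<le> (i + 1) * q" by simp_all
  then have "of_int (i * q) * s' \<le> of_int i' * s'" "of_int (i' + 1) * s' \<le> of_int ((i + 1) * q) * s'"
    using s(1) by (simp_all only: mult_le_cancel_right_pos of_int_le_iff)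
  then show ?thesis using s(2) by (auto simp: mult.assoc)
qed

lemma dyadic_cubes_nested:
  assumes mn: "m \<le> n" and C: "C \<in> dyadic_cubes d k I m" "C' \<in> dyadic_cubes d k I n" and ne: "C \<inter> C' \<noteq> {}"
  shows "C' \<subseteq> C"
proof -
  obtain i where i: "C = PiE {..<d} (\<lambda>j. {of_int (i j) * side m j ..< (of_int (i j) + 1) * side m j})"
    by (rule dyadic_cubesE[OF C(1)])
  obtain i' where i': "C' = PiE {..<d} (\<lambda>j. {of_int (i' j) * side n j ..< (of_int (i' j) + 1) * side n j})"
    by (rule dyadic_cubesE[OF C(2)])
  obtain x where x: "x \<in> C" "x \<in> C'" using ne by blast
  show ?thesis unfolding i i'
  proof (rule PiE_mono)
    fix j assume j: "j \<in> {..<d}"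
    show "{of_int (i' j) * side n j ..< (of_int (i' j) + 1) * side n j}
        \<subseteq> {of_int (i j) * side m j ..< (of_int (i j) + 1) * side m j}"
    proof (rule dyadic_interval_nested)
      show "side m j = of_int (2 ^ (k j * nat (n - m))) * side n j"
        using side_refine[OF mn] by simp
    qed (use PiE_mem[OF x(1)[unfolded i] j] PiE_mem[OF x(2)[unfolded i'] j] in simp_all)
  qed
qed

text \<open>The cube $C_{4l}$ about the centre of a dyadic cube of size \<open>l\<close> contains every comparable neighbour.\<close>

lemma dyadic_cube_doubling:
  assumes C: "C = PiE {..<d} (\<lambda>j. {lo j ..< lo j + side n j})" "C \<subseteq> Omega d I"
    and B: "B \<subseteq> Omega d I"
    and near: "\<And>y j. y \<in> B \<Longrightarrow> j < d \<Longrightarrow>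
      lo j - side n j \<le> y j \<and> y j < lo j + 2 * side n j \<or>
      lo j - (2 ^ k j - 1) * side n j \<le> y j \<and> y j < lo j + 2 ^ k j * side n j"
  shows "emeasure M B \<le> ennreal N0 * emeasure M C"
proof -
  define l :: real where "l = 2 powi (- n)"
  have l: "0 < l" by (simp add: l_def)
  have lk: "l ^ k j = side n j" for j by (simp add: l_def side_eq)
  define cen where "cen = restrict (\<lambda>j. lo j + side n j / 2) {..<d}"
  have "cen \<in> C" by (auto simp: C(1) cen_def)
  then have cen: "cen \<in> Omega d I" using C(2) by blast
  have sub: "centered_cube d k l cen \<subseteq> C"
    unfolding centered_cube_def C(1) lk by (intro PiE_mono) (auto simp: cen_def)
  have "B \<subseteq> centered_cube d k (4 * l) cen \<inter> Omega d I"
  proof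
    fix y assume y: "y \<in> B"
    then have y\<Omega>: "y \<in> Omega d I" using B by blast
    have "y j \<in> {cen j - (4 * l) ^ k j / 2 <..< cen j + (4 * l) ^ k j / 2}" if j: "j < d" for j
    proof -
      let ?s = "side n j" and ?t = "(2::real) ^ k j"
      \<comment> \<open>The half side \<open>?t * ?t * ?s / 2\<close> of the large cube is at least
        \<open>?t * ?s\<close> because \<open>?t \<ge> 2\<close>. It therefore exceeds the distances
        \<open>3 / 2 * ?s\<close> and \<open>(?t - 1 / 2) * ?s\<close> from the centre allowed by
        \<open>near\<close>; the first alternative serves shifted cubes of the same generation, the
        second the parent.\<close>
      have t: "2 \<le> ?t" using exponents_pos[OF j] power_increasing[of 1 "k j" "2::real"] by simp
      have "(4::real) ^ k j = ?t * ?t" by (simp add: power_mult_distrib[symmetric])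
      then have four: "(4 * l) ^ k j = ?t * ?t * ?s" by (simp add: power_mult_distrib lk)
      have "2 * ?t * ?s \<le> ?t * ?t * ?s" using t by (intro mult_right_mono) (auto intro: less_imp_le)
      moreover have "2 * ?s \<le> ?t * ?s" using t by (intro mult_right_mono) (auto intro: less_imp_le)
      moreover have c: "cen j = lo j + ?s / 2" using j by (simp add: cen_def)
      moreover have "lo j - ?s \<le> y j \<and> y j < lo j + 2 * ?s \<or>
          lo j - (?t * ?s - ?s) \<le> y j \<and> y j < lo j + ?t * ?s"
        using near[OF y j] by (simp only: left_diff_distrib mult_1)
      ultimately have "cen j - ?t * ?t * ?s / 2 < y j" "y j < cen j + ?t * ?t * ?s / 2"
        using side_pos[of n j] by linarith+
      then show ?thesis unfolding four by simp
    qed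
    then show "y \<in> centered_cube d k (4 * l) cen \<inter> Omega d I"
      using y\<Omega> by (auto simp: centered_cube_def Omega_def PiE_iff)
  qed
  moreover have "centered_cube d k (4 * l) cen \<inter> Omega d I \<in> sets M"
    using Omega_Int_box_sets[of "\<lambda>j. {cen j - (4 * l) ^ k j / 2 <..< cen j + (4 * l) ^ k j / 2}"]
    by (simp add: centered_cube_def Int_commute)
  ultimately have "emeasure M B \<le> emeasure M (centered_cube d k (4 * l) cen \<inter> Omega d I)"
    by (rule emeasure_mono)
  also have "\<dots> \<le> ennreal N0 * emeasure M (centered_cube d k l cen)"
    using sub C(2) by (intro doubling cen l) blast
  also have "\<dots> \<le> ennreal N0 * emeasure M C"
  proof -
    have "C \<in> sets M" using C(2) unfolding C(1) by (intro box_sets) auto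
    then show ?thesis using sub by (intro mult_left_mono emeasure_mono) auto
  qed
  finally show ?thesis .
qed

lemma dyadic_cubesE':
  assumes "C \<in> dyadic_cubes d k I n"
  obtains lo where "C = PiE {..<d} (\<lambda>j. {lo j ..< lo j + side n j})" "C \<subseteq> Omega d I"
proof -
  obtain i where "C = PiE {..<d} (\<lambda>j. {of_int (i j) * side n j ..< (of_int (i j) + 1) * side n j})"
    "C \<subseteq> Omega d I" by (rule dyadic_cubesE[OF assms])
  then show thesis by (intro that[of "\<lambda>j. of_int (i j) * side n j"]) (auto simp: distrib_right)
qed

text \<open>Containing the child, the parent extends at most \<open>2 ^ k j - 1\<close> child sides
  below the lower end of the child and less than \<open>2 ^ k j\<close> above it.\<close>

lemma dyadic_cube_parent:
  assumes C': "C' \<in> dyadic_cubes d k I n" and C: "C \<in> dyadic_cubes d k I (n - 1)" and sub: "C' \<subseteq> C"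
  shows "emeasure M C \<le> ennreal N0 * emeasure M C'"
proof -
  obtain lo where lo: "C' = PiE {..<d} (\<lambda>j. {lo j ..< lo j + side n j})" "C' \<subseteq> Omega d I"
    by (rule dyadic_cubesE'[OF C'])
  obtain Lo where Lo: "C = PiE {..<d} (\<lambda>j. {Lo j ..< Lo j + side (n - 1) j})" "C \<subseteq> Omega d I"
    by (rule dyadic_cubesE'[OF C])
  have side: "side (n - 1) j = 2 ^ k j * side n j" for j
    using side_refine[of "n - 1" n j] by simp
  have sub_j: "{lo j ..< lo j + side n j} \<subseteq> {Lo j ..< Lo j + side (n - 1) j}" if j: "j < d" for j
  proof -
    have "restrict lo {..<d} \<in> PiE {..<d} (\<lambda>j. {lo j ..< lo j + side n j})" by simp
    then show ?thesis
      using iffD1[OF subset_PiE sub[unfolded lo(1) Lo(1)]] j by blast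
  qed
  show ?thesis
  proof (rule dyadic_cube_doubling[OF lo Lo(2)])
    fix y j assume y: "y \<in> C" and j: "j < d"
    have "Lo j \<le> lo j" "lo j + side n j \<le> Lo j + side (n - 1) j"
      using iffD1[OF ivl_subset sub_j[OF j]] side_pos[of n j] by linarith+
    moreover have "y j \<in> {Lo j ..< Lo j + side (n - 1) j}"
      using PiE_mem[OF y[unfolded Lo(1)], of j] j by simp
    ultimately show "lo j - side n j \<le> y j \<and> y j < lo j + 2 * side n j \<or>
      lo j - (2 ^ k j - 1) * side n j \<le> y j \<and> y j < lo j + 2 ^ k j * side n j"
      unfolding side atLeastLessThan_iff left_diff_distrib mult_1 by linarith
  qed
qed

lemma dyadic_cube_finite:
  assumes "C \<in> dyadic_cubes d k I n"
  shows "emeasure M C < \<infinity>"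
proof -
  obtain lo where lo: "C = PiE {..<d} (\<lambda>j. {lo j ..< lo j + side n j})" "C \<subseteq> Omega d I"
    by (rule dyadic_cubesE'[OF assms])
  have "restrict lo {..<d} \<in> C" by (auto simp: lo(1))
  moreover have "corner_cube d k (2 powi (- n)) (restrict lo {..<d}) = C"
    unfolding corner_cube_def lo(1) by (intro PiE_cong) (simp add: side_eq)
  ultimately show ?thesis
    using finite_corner[of "restrict lo {..<d}" "2 powi (- n)"] lo(2) by auto
qed

lemma dyadic_cube_exists:
  assumes "x \<in> Omega d I"
  shows "\<exists>C\<in>dyadic_cubes d k I n. x \<in> C"
  using dyadic_partition[OF assms, of n] by blast

text \<open>The growth hypothesis concerns cubes with corner \<open>x\<close>, not dyadic ones. A
  corner cube of the same side as a dyadic cube \<open>C\<close> around \<open>x\<close> reaches at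
  most one side beyond \<open>C\<close>, so doubling bounds its measure by that of
  \<open>C\<close>.\<close>

lemma dyadic_cubes_unbounded:
  assumes x: "x \<in> Omega d I"
  shows "\<exists>n. \<exists>C\<in>dyadic_cubes d k I n. x \<in> C \<and> ennreal B < emeasure M C"
proof -
  have "ennreal N0 * ennreal B < \<infinity>" by (simp add: ennreal_mult_less_top)
  then have "\<forall>\<^sub>F l in at_top. ennreal N0 * ennreal B < emeasure M (corner_cube d k l x)"
    by (rule order_tendstoD(1)[OF corner_unbounded[OF x]])
  then obtain L where L: "\<And>l. L \<le> l \<Longrightarrow> ennreal N0 * ennreal B < emeasure M (corner_cube d k l x)"
    by (auto simp: eventually_at_top_linorder)
  obtain m :: nat where m: "L < 2 ^ m" using real_arch_pow[of 2 L] by auto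
  define n where "n = - int m"
  obtain C where C: "C \<in> dyadic_cubes d k I n" "x \<in> C" using dyadic_cube_exists[OF x] by blast
  obtain lo where lo: "C = PiE {..<d} (\<lambda>j. {lo j ..< lo j + side n j})" "C \<subseteq> Omega d I"
    by (rule dyadic_cubesE'[OF C(1)])
  have l: "(2::real) powi (- n) = 2 ^ m" by (simp add: n_def)
  have lk: "((2::real) ^ m) ^ k j = side n j" for j by (simp only: side_eq l)
  have "ennreal N0 * ennreal B < emeasure M (corner_cube d k (2 ^ m) x)"
    using m by (intro L) simp
  also have "\<dots> \<le> ennreal N0 * emeasure M C"
  proof (rule dyadic_cube_doubling[OF lo])
    show "corner_cube d k (2 ^ m) x \<subseteq> Omega d I"
      using x unfolding corner_cube_def Omega_def
      by (intro PiE_mono) (auto intro: interval_upward)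
    fix y j assume y: "y \<in> corner_cube d k (2 ^ m) x" and j: "j < d"
    have "y j \<in> {x j ..< x j + side n j}"
      using PiE_mem[OF y[unfolded corner_cube_def lk], of j] j by simp
    moreover have "x j \<in> {lo j ..< lo j + side n j}"
      using PiE_mem[OF C(2)[unfolded lo(1)], of j] j by simp
    ultimately show "lo j - side n j \<le> y j \<and> y j < lo j + 2 * side n j \<or>
      lo j - (2 ^ k j - 1) * side n j \<le> y j \<and> y j < lo j + 2 ^ k j * side n j"
      using side_pos[of n j] by simp
  qed
  finally have "\<not> emeasure M C \<le> ennreal B"
    using mult_left_mono[of "emeasure M C" "ennreal B" "ennreal N0"] by (auto simp: not_le[symmetric])
  then have "ennreal B < emeasure M C" by simp
  with C show ?thesis by blast
qed

text \<open>Doubling would pass a zero measure from a cube to its parent and hence to all ancestors,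
  against their unbounded measure.\<close>

lemma dyadic_cube_pos:
  assumes C: "C \<in> dyadic_cubes d k I n"
  shows "0 < emeasure M C"
proof (rule ccontr)
  assume "\<not> ?thesis"
  then have zero: "emeasure M C = 0" by (simp add: zero_less_iff_neq_zero)
  obtain lo where lo: "C = PiE {..<d} (\<lambda>j. {lo j ..< lo j + side n j})" "C \<subseteq> Omega d I"
    by (rule dyadic_cubesE'[OF C])
  define x where "x = restrict lo {..<d}"
  have "x \<in> C" by (auto simp: lo(1) x_def)
  then have x: "x \<in> Omega d I" using lo(2) by blast
  have anc: "emeasure M C' = 0" if "C' \<in> dyadic_cubes d k I (n - int m)" "x \<in> C'" for m C'
    using that
  proof (induction m arbitrary: C')
    case 0
    then have "C' \<subseteq> C" using dyadic_cubes_nested[of n n C C'] C \<open>x \<in> C\<close> by auto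
    then show ?case using zero emeasure_mono[of C' C M] dyadic_cube_sets[OF C] by simp
  next
    case (Suc m)
    obtain C'' where C'': "C'' \<in> dyadic_cubes d k I (n - int m)" "x \<in> C''"
      using dyadic_cube_exists[OF x] by blast
    have parent: "C' \<in> dyadic_cubes d k I (n - int m - 1)" using Suc.prems(1) by (simp add: algebra_simps)
    have "C'' \<subseteq> C'"
      by (rule dyadic_cubes_nested[OF _ parent C''(1)]) (use C'' Suc.prems in auto)
    then have "emeasure M C' \<le> ennreal N0 * emeasure M C''"
      by (rule dyadic_cube_parent[OF C''(1) parent])
    then show ?case using Suc.IH[OF C''] by simp
  qed
  obtain n' C' where C': "C' \<in> dyadic_cubes d k I n'" "x \<in> C'" "ennreal 0 < emeasure M C'"
    using dyadic_cubes_unbounded[OF x] by blast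
  have "emeasure M C' = 0"
  proof (cases "n \<le> n'")
    case True
    then have "C' \<subseteq> C" using dyadic_cubes_nested[OF True C C'(1)] \<open>x \<in> C\<close> C'(2) by auto
    then show ?thesis using zero emeasure_mono[of C' C M] dyadic_cube_sets[OF C] by simp
  next
    case False
    then show ?thesis using anc[of C' "nat (n - n')"] C' by simp
  qed
  with C'(3) show False by simp
qed

text \<open>Measurability of the identity reduces the claim to coordinate half-spaces. The
  half-space \<open>x j < a\<close> is a countable union of dyadic cubes: the strict inequality
  leaves room for a small cube around each point, whose side in direction \<open>j\<close> is at
  most \<open>(1 / 2) ^ m\<close> because \<open>k j \<ge> 1\<close>.\<close>

lemma dyadic_cubes_generate:
  "sets M \<subseteq> sigma_sets (space M) (\<Union>n. dyadic_cubes d k I n)"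
proof -
  define N where "N = sigma (space M) (\<Union>n. dyadic_cubes d k I n)"
  have sub: "(\<Union>n. dyadic_cubes d k I n) \<subseteq> Pow (space M)"
    unfolding space_M by (auto simp: dyadic_cubes_def)
  have N: "space N = Omega d I" "sets N = sigma_sets (space M) (\<Union>n. dyadic_cubes d k I n)"
    using sub by (simp_all add: N_def space_M[symmetric])
  have "(\<lambda>x. x) \<in> measurable N (PiM {..<d} (\<lambda>_. borel))"
  proof (rule measurable_PiM_single')
    show "(\<lambda>x. x) \<in> space N \<rightarrow> (\<Pi>\<^sub>E i\<in>{..<d}. space borel)"
      by (auto simp: N Omega_def)
    fix j assume "j \<in> {..<d}"
    then have j: "j < d" by simp
    show "(\<lambda>x. x j) \<in> borel_measurable N"
      unfolding borel_measurable_iff_less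
    proof
      fix a
      have "{x \<in> space N. x j < a} = \<Union>{C \<in> (\<Union>n. dyadic_cubes d k I n). C \<subseteq> {x. x j < a}}"
      proof (intro set_eqI iffI)
        fix x assume "x \<in> {x \<in> space N. x j < a}"
        then have x: "x \<in> Omega d I" "x j < a" by (auto simp: N)
        obtain m where m: "(1 / 2) ^ m < a - x j"
          using real_arch_pow_inv[of "a - x j" "1 / 2"] x(2) by auto
        have l: "(2::real) powi (- int m) = (1 / 2) ^ m" by (simp add: power_int_minus power_one_over inverse_eq_divide)
        have "side (int m) j \<le> (1 / 2) ^ m"
        proof -
          have "side (int m) j = ((1 / 2) ^ m) ^ k j" by (simp only: side_eq l)
          also have "\<dots> \<le> ((1 / 2) ^ m) ^ 1"
            using exponents_pos[OF j] by (intro power_decreasing) (auto simp: power_le_one)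
          finally show ?thesis by simp
        qed
        obtain C where C: "C \<in> dyadic_cubes d k I (int m)" "x \<in> C"
          using dyadic_cube_exists[OF x(1)] by blast
        have "C \<subseteq> {y. y j < a}"
        proof
          fix y assume "y \<in> C"
          then have "\<bar>y j - x j\<bar> < side (int m) j" by (rule dyadic_cube_width[OF C(1) _ C(2) j])
          then show "y \<in> {y. y j < a}" using m \<open>side (int m) j \<le> (1 / 2) ^ m\<close> by auto
        qed
        then show "x \<in> \<Union>{C \<in> (\<Union>n. dyadic_cubes d k I n). C \<subseteq> {x. x j < a}}" using C by blast
      next
        fix x assume "x \<in> \<Union>{C \<in> (\<Union>n. dyadic_cubes d k I n). C \<subseteq> {x. x j < a}}"
        then show "x \<in> {x \<in> space N. x j < a}"
          using sub unfolding N(1) space_M by blast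
      qed
      moreover have "countable {C \<in> (\<Union>n. dyadic_cubes d k I n). C \<subseteq> {x. x j < a}}"
        by (rule countable_subset[of _ "\<Union>n. dyadic_cubes d k I n"]) (auto intro: countable_dyadic_cubes)
      moreover have "(\<Union>n. dyadic_cubes d k I n) \<subseteq> sets N"
        unfolding N(2) by (rule subsetI) (rule sigma_sets.Basic)
      then have "{C \<in> (\<Union>n. dyadic_cubes d k I n). C \<subseteq> {x. x j < a}} \<subseteq> sets N" by blast
      ultimately show "{x \<in> space N. x j < a} \<in> sets N"
        by (simp only: sets.countable_Union)
    qed
  qed
  have "Omega d I \<inter> B \<in> sets N" if B: "B \<in> sets (PiM {..<d} (\<lambda>_. borel))" for B
    using measurable_sets[OF \<open>(\<lambda>x. x) \<in> measurable N (PiM {..<d} (\<lambda>_. borel))\<close> B]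
    by (simp add: N(1) vimage_def Int_commute Int_def)
  then show ?thesis
    unfolding N(2)[symmetric] sets_M sets_restrict_space by blast
qed

text \<open>\<open>N0\<close> is an arbitrary real number; the maximum with 1 supplies a positive
  doubling constant that still depends on \<open>N0\<close> alone.\<close>

sublocale dyadic_lattice M "dyadic_cubes d k I" "max 1 N0"
proof
  fix C C' n assume "C' \<in> dyadic_cubes d k I n" "C \<in> dyadic_cubes d k I (n - 1)" "C' \<subseteq> C"
  then have "emeasure M C \<le> ennreal N0 * emeasure M C'" by (rule dyadic_cube_parent)
  also have "\<dots> \<le> ennreal (max 1 N0) * emeasure M C'" by (intro mult_right_mono ennreal_leI) auto
  finally show "emeasure M C \<le> ennreal (max 1 N0) * emeasure M C'" .
qed (fact dyadic_cube_sets countable_dyadic_cubes dyadic_cubes_nested dyadic_cube_pos dyadic_cube_finite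
      dyadic_cubes_generate | simp add: space_M dyadic_cube_exists dyadic_cubes_unbounded)+

section \<open>The null boundary and coverings by inner cubes\<close>

lemma closed_interval:
  assumes "j < d"
  shows "closed (I j)"
  using intervals[OF assms] by (elim disjE exE) simp_all

text \<open>The product of the closed intervals is closed, and its interior is the product of the
  interiors: projections are open, and finitely many open factors form an open box. So the null
  frontier consists of the points with some coordinate outside the interior of its interval.\<close>

lemma AE_interior: "AE x in M. \<forall>j<d. x j \<in> interior (I j)"
proof -
  let ?T = "product_topology (\<lambda>_. euclidean :: real topology) {..<d}"
  have "?T closure_of Omega d I = PiE {..<d} (\<lambda>j. closure (I j))"
    unfolding Omega_def by (simp add: closure_of_product_topology)
  also have "\<dots> = Omega d I"
    unfolding Omega_def by (rule PiE_cong) (use closed_interval in simp)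
  finally have cl: "?T closure_of Omega d I = Omega d I" .
  have int_sub: "x j \<in> interior (I j)" if x: "x \<in> ?T interior_of Omega d I" and j: "j < d" for x j
  proof -
    have "open ((\<lambda>x. x j) ` (?T interior_of Omega d I))"
      using open_map_product_projection[of j "{..<d}" "\<lambda>_. euclidean :: real topology"] j
      by (simp add: open_map_def)
    moreover have "(\<lambda>x. x j) ` (?T interior_of Omega d I) \<subseteq> I j"
    proof
      fix t assume "t \<in> (\<lambda>x. x j) ` (?T interior_of Omega d I)"
      then obtain y where "t = y j" "y \<in> Omega d I"
        using interior_of_subset[of ?T "Omega d I"] by blast
      then show "t \<in> I j" using PiE_mem[of y "{..<d}" I j] j by (simp add: Omega_def)
    qed
    ultimately have "(\<lambda>x. x j) ` (?T interior_of Omega d I) \<subseteq> interior (I j)"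
      by (intro interior_maximal)
    then show ?thesis using x by blast
  qed
  have box: "PiE {..<d} (\<lambda>j. interior (I j)) \<subseteq> ?T interior_of Omega d I"
  proof (rule interior_of_maximal)
    show "PiE {..<d} (\<lambda>j. interior (I j)) \<subseteq> Omega d I"
      unfolding Omega_def by (rule PiE_mono) (rule interior_subset)
    show "openin ?T (PiE {..<d} (\<lambda>j. interior (I j)))" by (simp add: openin_PiE)
  qed
  have eq: "?T interior_of Omega d I = PiE {..<d} (\<lambda>j. interior (I j))"
  proof
    show "?T interior_of Omega d I \<subseteq> PiE {..<d} (\<lambda>j. interior (I j))"
    proof
      fix x assume x: "x \<in> ?T interior_of Omega d I"
      then have "x \<in> Omega d I" using interior_of_subset[of ?T "Omega d I"] by blast
      then have "x \<in> extensional {..<d}" by (simp add: Omega_def PiE_def)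
      then show "x \<in> PiE {..<d} (\<lambda>j. interior (I j))"
        using int_sub[OF x] by (simp add: PiE_iff)
    qed
  qed (rule box)
  have fr: "?T frontier_of Omega d I = Omega d I - Omega d I \<inter> PiE {..<d} (\<lambda>j. interior (I j))"
    unfolding frontier_of_def cl eq[symmetric] by blast
  have "Omega d I \<inter> PiE {..<d} (\<lambda>j. interior (I j)) \<in> sets M"
    by (rule Omega_Int_box_sets) simp
  then have "space M - Omega d I \<inter> PiE {..<d} (\<lambda>j. interior (I j)) \<in> sets M"
    by (rule sets.compl_sets)
  then have "?T frontier_of Omega d I \<in> sets M" unfolding fr space_M .
  then have "?T frontier_of Omega d I \<in> null_sets M"
    using boundary_null by (rule null_setsI[rotated])
  then show ?thesis
  proof (rule AE_I')
    show "{x \<in> space M. \<not> (\<forall>j<d. x j \<in> interior (I j))} \<subseteq> ?T frontier_of Omega d I"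
      unfolding fr space_M using PiE_mem by fastforce
  qed
qed

text \<open>
  A half-open dyadic cube is, up to the null boundary of \<open>\<Omega>\<close>, contained in a slightly larger open
  cube of \<open>\<Omega>\<close>, which extends upwards in the coordinates in which the dyadic cube touches the boundary
  and downwards in the others.
\<close>

lemma inner_cube_covering:
  assumes C: "C \<in> dyadic_cubes d k I n"
  shows "\<exists>Q\<in>inner_cubes d k I. Q \<in> sets M \<and> emeasure M Q \<le> ennreal N0 * emeasure M C \<and>
    (AE x in M. x \<in> C \<longrightarrow> x \<in> Q)"
proof -
  obtain lo where lo: "C = PiE {..<d} (\<lambda>j. {lo j ..< lo j + side n j})" "C \<subseteq> Omega d I"
    by (rule dyadic_cubesE'[OF C])
  have lo_mem: "lo j \<in> I j" if "j < d" for j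
  proof -
    have "restrict lo {..<d} \<in> C" unfolding lo(1) by simp
    then have "restrict lo {..<d} \<in> Omega d I" using lo(2) by blast
    then show ?thesis using PiE_mem[of "restrict lo {..<d}" "{..<d}" I j] that by (simp add: Omega_def)
  qed
  define l :: real where "l = 2 powi (- n)"
  have l: "0 < l" by (simp add: l_def)
  have lk: "l ^ k j = side n j" for j by (simp add: l_def side_eq)
  \<comment> \<open>The enlarged side must stay below twice the old one, so that doubling applies,
    and an interior lower end must stay interior when it is moved down. Both hold for
    \<open>l'\<close> close enough to \<open>l\<close>.\<close>
  let ?P = "\<lambda>j l'. l' ^ k j < 2 * side n j \<and>
    (lo j \<in> interior (I j) \<longrightarrow> lo j + side n j - l' ^ k j \<in> interior (I j))"
  have "\<forall>\<^sub>F l' in at_right l. ?P j l'" for j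
  proof -
    have lim: "((\<lambda>l'. l' ^ k j) \<longlongrightarrow> side n j) (at_right l)"
      unfolding lk[symmetric] by (intro tendsto_intros)
    have 1: "\<forall>\<^sub>F l' in at_right l. l' ^ k j < 2 * side n j"
      by (rule order_tendstoD(2)[OF lim]) simp
    have "((\<lambda>l'. lo j + side n j - l' ^ k j) \<longlongrightarrow> lo j + side n j - side n j) (at_right l)"
      by (intro tendsto_intros lim)
    then have lim2: "((\<lambda>l'. lo j + side n j - l' ^ k j) \<longlongrightarrow> lo j) (at_right l)" by simp
    have 2: "\<forall>\<^sub>F l' in at_right l. lo j \<in> interior (I j) \<longrightarrow> lo j + side n j - l' ^ k j \<in> interior (I j)"
    proof (cases "lo j \<in> interior (I j)")
      case True
      then show ?thesis using topological_tendstoD[OF lim2 open_interior True] by simp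
    qed simp
    show ?thesis using 1 2 by (rule eventually_conj)
  qed
  then have "\<forall>\<^sub>F l' in at_right l. \<forall>j\<in>{..<d}. ?P j l'"
    by (intro eventually_ball_finite) simp_all
  moreover have "\<forall>\<^sub>F l' in at_right l. l < l'" by (rule eventually_at_right_less)
  ultimately have "\<forall>\<^sub>F l' in at_right l. (\<forall>j\<in>{..<d}. ?P j l') \<and> l < l'" by (rule eventually_conj)
  then obtain l' where l': "\<And>j. j < d \<Longrightarrow> ?P j l'" "l < l'"
    using eventually_happens[of _ "at_right l"] by fastforce
  have l'0: "0 < l'" using l l'(2) by simp
  have L: "side n j < l' ^ k j" if j: "j < d" for j
    unfolding lk[symmetric] using l l'(2) exponents_pos[OF j] by (intro power_strict_mono) auto
  \<comment> \<open>In the first case the open side ends where the side of \<open>C\<close> ends. In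
    the second it starts at \<open>lo j\<close>, which loses only the face
    \<open>x j = lo j\<close>, a part of the null boundary.\<close>
  define c where "c = restrict (\<lambda>j. if lo j \<in> interior (I j)
    then lo j + side n j - l' ^ k j / 2 else lo j + l' ^ k j / 2) {..<d}"
  define X where "X j = {c j - l' ^ k j / 2 <..< c j + l' ^ k j / 2}" for j
  have Q: "centered_cube d k l' c = PiE {..<d} X"
    unfolding centered_cube_def by (rule PiE_cong) (simp add: X_def)
  have c_low: "c j - l' ^ k j / 2 \<in> I j" if j: "j < d" for j
    using l'(1)[OF j] lo_mem[OF j] interior_subset[of "I j"] j by (auto simp: c_def)
  have X_sub: "X j \<subseteq> I j" if j: "j < d" for j
    using interval_upward[OF j c_low[OF j]] by (auto simp: X_def)
  have Q_sub: "PiE {..<d} X \<subseteq> Omega d I"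
    unfolding Omega_def by (rule PiE_mono) (use X_sub in simp)
  have "c \<in> PiE {..<d} X"
    using l'0 by (auto simp: X_def c_def)
  then have "c \<in> Omega d I" using Q_sub by blast
  then have inner: "PiE {..<d} X \<in> inner_cubes d k I"
    unfolding inner_cubes_def Q[symmetric] using l'0 Q_sub[folded Q] by blast
  have sets: "PiE {..<d} X \<in> sets M"
    by (rule box_sets[OF _ Q_sub]) (simp add: X_def)
  have bound: "emeasure M (PiE {..<d} X) \<le> ennreal N0 * emeasure M C"
  proof (rule dyadic_cube_doubling[OF lo Q_sub])
    fix y j assume y: "y \<in> PiE {..<d} X" and j: "j < d"
    have "y j \<in> X j" using PiE_mem[OF y] j by simp
    moreover have "l' ^ k j < 2 * side n j" using l'(1)[OF j] by simp
    moreover have "c j = lo j + side n j - l' ^ k j / 2 \<or> c j = lo j + l' ^ k j / 2"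
      using j by (simp add: c_def)
    ultimately have "lo j - side n j \<le> y j \<and> y j < lo j + 2 * side n j"
      using L[OF j] unfolding X_def greaterThanLessThan_iff by linarith
    then show "lo j - side n j \<le> y j \<and> y j < lo j + 2 * side n j \<or>
      lo j - (2 ^ k j - 1) * side n j \<le> y j \<and> y j < lo j + 2 ^ k j * side n j" ..
  qed
  have "AE x in M. x \<in> C \<longrightarrow> x \<in> PiE {..<d} X"
    using AE_interior
  proof eventually_elim
    fix x assume int: "\<forall>j<d. x j \<in> interior (I j)"
    show "x \<in> C \<longrightarrow> x \<in> PiE {..<d} X"
    proof
      assume x: "x \<in> C"
      have "x j \<in> X j" if j: "j < d" for j
      proof -
        have xj: "lo j \<le> x j" "x j < lo j + side n j"
          using PiE_mem[OF x[unfolded lo(1)], of j] j by auto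
        show ?thesis
        proof (cases "lo j \<in> interior (I j)")
          case True
          then have "c j = lo j + side n j - l' ^ k j / 2" using j by (simp add: c_def)
          then show ?thesis using xj L[OF j] by (simp add: X_def)
        next
          case False
          then have "c j = lo j + l' ^ k j / 2" using j by (simp add: c_def)
          moreover have "lo j \<noteq> x j" using int j False by metis
          ultimately show ?thesis using xj L[OF j] by (simp add: X_def)
        qed
      qed
      moreover have "x \<in> extensional {..<d}" using x unfolding lo(1) by (simp add: PiE_def)
      ultimately show "x \<in> PiE {..<d} X" by (simp add: PiE_iff)
    qed
  qed
  then show ?thesis using inner sets bound by blast
qed

section \<open>The weight on dyadic cubes and the resulting estimate\<close>

text \<open>Both integrals grow when \<open>C\<close> is replaced by the covering inner cube
  \<open>Q\<close>, on which the condition is known. Turning averages into integrals produces the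
  total power \<open>p\<close> of the measure of \<open>Q\<close>, whence the factor
  \<open>(max 1 N0) powr p\<close>.\<close>

lemma weight_dyadic:
  assumes w: "weight d k I M w" and C: "C \<in> dyadic_cubes d k I n" and p: "1 < p"
    and Ap: "Ap_bound d k I M p w (ennreal a)" and a: "0 \<le> a"
  shows "(\<integral>\<^sup>+x\<in>C. w x \<partial>M) < \<infinity>"
    and "(\<integral>\<^sup>+x\<in>C. w x \<partial>M) * epow (\<integral>\<^sup>+x\<in>C. epow (inverse (w x)) (1 / (p - 1)) \<partial>M) (p - 1)
      \<le> ennreal (a * (max 1 N0) powr p) * epow (emeasure M C) p"
proof -
  obtain Q where Q: "Q \<in> inner_cubes d k I" "Q \<in> sets M" "emeasure M Q \<le> ennreal N0 * emeasure M C"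
    "AE x in M. x \<in> C \<longrightarrow> x \<in> Q" using inner_cube_covering[OF C] by blast
  define \<sigma> where "\<sigma> x = epow (inverse (w x)) (1 / (p - 1))" for x
  define q where "q = emeasure M Q"
  have "emeasure M C \<le> q" unfolding q_def by (rule emeasure_mono_AE[OF Q(4,2)])
  then have q0: "q \<noteq> 0" using dyadic_cube_pos[OF C] by auto
  have "q \<le> ennreal N0 * emeasure M C" using Q(3) by (simp add: q_def)
  also have "\<dots> \<le> ennreal (max 1 N0) * emeasure M C" by (intro mult_right_mono ennreal_leI) auto
  finally have q_le: "q \<le> ennreal (max 1 N0) * emeasure M C" .
  then have q1: "q \<noteq> top"
    using dyadic_cube_finite[OF C] by (auto simp: top_unique ennreal_mult_eq_top_iff)
  have avg: "(\<integral>\<^sup>+x\<in>Q. u x \<partial>M) = avg M Q u * q" for u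
  proof -
    have "q / q = 1" using q0 q1 by (intro ennreal_divide_self) (simp_all add: less_top[symmetric])
    then show ?thesis unfolding avg_def q_def[symmetric] by (simp add: ennreal_divide_times)
  qed
  have mono: "(\<integral>\<^sup>+x\<in>C. u x \<partial>M) \<le> (\<integral>\<^sup>+x\<in>Q. u x \<partial>M)" for u :: "_ \<Rightarrow> ennreal"
    using Q(4) by (intro nn_integral_mono_AE) (auto elim!: eventually_mono split: split_indicator)
  have "avg M Q w < \<infinity>" using w Q(1) by (simp add: weight_def)
  then have "(\<integral>\<^sup>+x\<in>Q. w x \<partial>M) < \<infinity>" unfolding avg using q1 by (simp add: ennreal_mult_less_top less_top)
  then show "(\<integral>\<^sup>+x\<in>C. w x \<partial>M) < \<infinity>" using mono[of w] by (rule le_less_trans[rotated])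
  have "(\<integral>\<^sup>+x\<in>C. w x \<partial>M) * epow (\<integral>\<^sup>+x\<in>C. \<sigma> x \<partial>M) (p - 1)
      \<le> (\<integral>\<^sup>+x\<in>Q. w x \<partial>M) * epow (\<integral>\<^sup>+x\<in>Q. \<sigma> x \<partial>M) (p - 1)"
    using p by (intro mult_mono mono epow_mono) auto
  also have "\<dots> = (avg M Q w * epow (avg M Q \<sigma>) (p - 1)) * (q * epow q (p - 1))"
    unfolding avg epow_mult by (simp add: mult_ac)
  also have "q * epow q (p - 1) = epow q p" using epow_add[of q 1 "p - 1"] by simp
  also have "avg M Q w * epow (avg M Q \<sigma>) (p - 1) \<le> ennreal a"
    using Ap Q(1) unfolding Ap_bound_def \<sigma>_def by blast
  then have "(avg M Q w * epow (avg M Q \<sigma>) (p - 1)) * epow q p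
      \<le> ennreal a * epow (ennreal (max 1 N0) * emeasure M C) p"
    using p q_le by (intro mult_mono epow_mono) auto
  also have "\<dots> = ennreal (a * (max 1 N0) powr p) * epow (emeasure M C) p"
    using a by (simp add: epow_mult epow_ennreal ennreal_mult mult_ac)
  finally show "(\<integral>\<^sup>+x\<in>C. w x \<partial>M) * epow (\<integral>\<^sup>+x\<in>C. epow (inverse (w x)) (1 / (p - 1)) \<partial>M) (p - 1)
      \<le> ennreal (a * (max 1 N0) powr p) * epow (emeasure M C) p"
    by (simp only: \<sigma>_def)
qed

text \<open>Indicators replace the index set depending on \<open>x\<close> by a fixed countable one.
  The added terms are 0, the least element of \<open>ennreal\<close>, and leave the supremum
  unchanged.\<close>

lemma borel_measurable_SUP_containing_cube:
  fixes v :: "(nat \<Rightarrow> real) set \<Rightarrow> ennreal"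
  shows "(\<lambda>x. SUP C\<in>{C \<in> all_dyadic_cubes d k I. x \<in> C}. v C) \<in> borel_measurable M"
proof -
  have eq: "(SUP C\<in>{C \<in> all_dyadic_cubes d k I. x \<in> C}. v C)
      = (SUP C\<in>all_dyadic_cubes d k I. v C * indicator C x)" for x
    by (intro antisym SUP_least) (auto intro!: SUP_upper2 split: split_indicator)
  have "countable (all_dyadic_cubes d k I)"
    unfolding all_dyadic_cubes_def by (rule countable_all_D)
  moreover have "C \<in> sets M" if "C \<in> all_dyadic_cubes d k I" for C
    using that dyadic_cube_sets unfolding all_dyadic_cubes_def by blast
  ultimately show ?thesis unfolding eq by (intro borel_measurable_SUP) auto
qed

lemma weighted_sharp_bound:
  assumes \<gamma>: "0 < \<gamma>" "\<gamma> \<le> 1" and p: "1 < p" and w: "weight d k I M w"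
    and Ap: "Ap_bound d k I M p w (ennreal a)" and a: "0 \<le> a"
    and f: "f \<in> Lp_space p (density M w)"
  shows "Lp_norm p (density M w) (\<lambda>x. ennreal \<bar>f x\<bar>)
    \<le> ennreal (sharp_const (max 1 N0) (max 1 (a * (max 1 N0) powr p) powr (1 / \<gamma>)) (p / \<gamma>) powr (1 / p))
      * Lp_norm p (density M w) (dyadic_sharp d k I M \<gamma> f)"
proof -
  define W where "W = density M w"
  define A where "A = max 1 (a * (max 1 N0) powr p)"
  have A: "1 \<le> A" by (simp add: A_def)
  have w_meas [measurable]: "w \<in> borel_measurable M" and w_AE: "AE x in M. 0 < w x \<and> w x < \<infinity>"
    using w by (simp_all add: weight_def)
  have WC: "emeasure W C = (\<integral>\<^sup>+x\<in>C. w x \<partial>M)" if "C \<in> sets M" for C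
    using that by (simp add: W_def emeasure_density)
  have fin: "emeasure W C < \<infinity>" if C: "C \<in> dyadic_cubes d k I n" for C n
    using weight_dyadic(1)[OF w C p Ap a] WC[OF dyadic_cube_sets[OF C]] by simp
  have pos: "0 < emeasure W C" if C: "C \<in> dyadic_cubes d k I n" for C n
  proof (rule ccontr)
    have Cs [measurable]: "C \<in> sets M" by (rule dyadic_cube_sets[OF C])
    assume "\<not> ?thesis"
    then have "(\<integral>\<^sup>+x\<in>C. w x \<partial>M) = 0" using WC[OF Cs] by (simp add: zero_less_iff_neq_zero)
    then have "AE x in M. w x * indicator C x = 0" by (subst (asm) nn_integral_0_iff_AE) auto
    with w_AE have "AE x in M. x \<notin> C" by eventually_elim (auto split: split_indicator_asm)
    then have "emeasure M C = 0" using Cs by (simp add: AE_iff_null_sets[OF Cs, symmetric] null_setsD1)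
    then show False using dyadic_cube_pos[OF C] by simp
  qed
  \<comment> \<open>The exponent \<open>p / \<gamma>\<close> is reached with
    \<open>\<theta> = 1 / \<gamma> \<ge> 1\<close>, which raises the constant to the same power. The
    maximum in \<open>A\<close> provides the lower bound 1.\<close>
  interpret weighted_dyadic_lattice M "dyadic_cubes d k I" "max 1 N0" W "p / \<gamma>" "A powr (1 / \<gamma>)"
  proof
    show "sets W = sets M" by (simp add: W_def)
    show "N \<in> null_sets W" if "N \<in> null_sets M" for N
      using absolutely_continuousI_density[OF w_meas] that
      by (auto simp: W_def absolutely_continuous_def)
    show "1 \<le> A powr (1 / \<gamma>)" using A \<gamma> by (simp add: ge_one_powr_ge_zero)
    show "0 < p / \<gamma>" using p \<gamma> by simp
    fix C n and h :: "(nat \<Rightarrow> real) \<Rightarrow> ennreal"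
    assume C: "C \<in> dyadic_cubes d k I n" and h: "h \<in> borel_measurable M"
    have "(\<integral>\<^sup>+x\<in>C. w x \<partial>M) * epow (\<integral>\<^sup>+x\<in>C. epow (inverse (w x)) (1 / (p - 1)) \<partial>M) (p - 1)
        \<le> ennreal (a * (max 1 N0) powr p) * epow (emeasure M C) p"
      by (rule weight_dyadic(2)[OF w C p Ap a])
    also have "\<dots> \<le> ennreal A * epow (emeasure M C) p"
      by (intro mult_right_mono ennreal_leI) (auto simp: A_def)
    finally have "epow (\<integral>\<^sup>+x\<in>C. h x \<partial>M) (p * (1 / \<gamma>)) * emeasure W C
        \<le> ennreal (A powr (1 / \<gamma>)) * epow (emeasure M C) (p * (1 / \<gamma>))
          * (\<integral>\<^sup>+x\<in>C. epow (h x) (p * (1 / \<gamma>)) \<partial>W)"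
      using \<gamma> A unfolding W_def
      by (intro muckenhoupt_condition[OF dyadic_cube_sets[OF C] w_meas h w_AE p _ dyadic_cube_finite[OF C]
            pos[OF C, unfolded W_def] fin[OF C, unfolded W_def]]) auto
    then show "epow (\<integral>\<^sup>+x\<in>C. h x \<partial>M) (p / \<gamma>) * emeasure W C
        \<le> ennreal (A powr (1 / \<gamma>)) * epow (emeasure M C) (p / \<gamma>) * (\<integral>\<^sup>+x\<in>C. epow (h x) (p / \<gamma>) \<partial>W)"
      by simp
  qed (use pos fin in blast)+
  let ?N = "sharp_const (max 1 N0) (A powr (1 / \<gamma>)) (p / \<gamma>)"
  let ?s = "dyadic_sharp d k I M \<gamma> f"
  have f_meas [measurable]: "f \<in> borel_measurable M"
    using f by (simp add: Lp_space_def)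
  define g where "g x = \<bar>f x\<bar> powr \<gamma>" for x
  \<comment> \<open>With this order of the difference, the iterated integral of \<kappa> is that of
    \<open>dyadic_sharp\<close> up to renaming bound variables, and no exchange of integrals is
    required.\<close>
  define \<kappa> where "\<kappa> z y = ennreal (\<bar>f y - f z\<bar> powr \<gamma>)" for z y
  define h where "h x = epow (?s x) \<gamma>" for x
  have s_meas [measurable]: "?s \<in> borel_measurable M"
    unfolding dyadic_sharp_def by (rule borel_measurable_SUP_containing_cube)
  have gp: "ennreal (g x powr (p / \<gamma>)) = epow (ennreal \<bar>f x\<bar>) p" for x
    using \<gamma> by (simp add: g_def powr_powr epow_ennreal)
  have hp: "epow (h x) (p / \<gamma>) = epow (?s x) p" for x
    using \<gamma> by (simp add: h_def epow_epow)
  have "(\<integral>\<^sup>+x. ennreal (g x powr (p / \<gamma>)) \<partial>W) \<le> ennreal ?N * (\<integral>\<^sup>+x. epow (h x) (p / \<gamma>) \<partial>W)"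
  proof (rule sharp_bound)
    show "g \<in> borel_measurable M" unfolding g_def by measurable
    show "0 \<le> g x" for x by (simp add: g_def)
    show "(\<integral>\<^sup>+x. ennreal (g x powr (p / \<gamma>)) \<partial>W) < \<infinity>"
      using f unfolding gp by (simp add: Lp_space_def Lp_norm_def W_def)
    show "case_prod \<kappa> \<in> borel_measurable (M \<Otimes>\<^sub>M M)" unfolding \<kappa>_def by measurable
    show "h \<in> borel_measurable M" unfolding h_def by measurable
    fix z y
    have "\<bar>f z\<bar> powr \<gamma> \<le> (\<bar>f y - f z\<bar> + \<bar>f y\<bar>) powr \<gamma>"
      using \<gamma> by (intro powr_mono2) auto
    also have "\<dots> \<le> \<bar>f y - f z\<bar> powr \<gamma> + \<bar>f y\<bar> powr \<gamma>"
      using \<gamma> by (intro powr_add_le) auto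
    finally show "ennreal (g z) \<le> \<kappa> z y + ennreal (g y)"
      unfolding g_def \<kappa>_def by (simp add: ennreal_plus[symmetric] ennreal_leI del: ennreal_plus)
  next
    fix n P x assume P: "P \<in> dyadic_cubes d k I n" and x: "x \<in> P"
    let ?J = "\<integral>\<^sup>+z\<in>P. (\<integral>\<^sup>+y\<in>P. \<kappa> z y \<partial>M) \<partial>M"
    have "epow (?J / (emeasure M P)\<^sup>2) (1 / \<gamma>) \<le> ?s x"
      unfolding dyadic_sharp_def \<kappa>_def
      by (rule SUP_upper) (use P x in \<open>auto simp: all_dyadic_cubes_def\<close>)
    then have "epow (epow (?J / (emeasure M P)\<^sup>2) (1 / \<gamma>)) \<gamma> \<le> h x"
      unfolding h_def using \<gamma> by (intro epow_mono) auto
    then have "?J / (emeasure M P)\<^sup>2 \<le> h x" using \<gamma> by (simp add: epow_epow)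
    then have "?J / (emeasure M P)\<^sup>2 * (emeasure M P)\<^sup>2 \<le> h x * (emeasure M P)\<^sup>2"
      by (rule mult_right_mono) simp
    moreover have "(emeasure M P)\<^sup>2 / (emeasure M P)\<^sup>2 = 1"
      using dyadic_cube_pos[OF P] dyadic_cube_finite[OF P]
      by (intro ennreal_divide_self) (auto simp: power2_eq_square ennreal_mult_less_top)
    ultimately show "?J \<le> h x * (emeasure M P)\<^sup>2"
      by (simp add: ennreal_divide_times)
  qed
  then have "epow (\<integral>\<^sup>+x. epow (ennreal \<bar>f x\<bar>) p \<partial>W) (1 / p)
      \<le> epow (ennreal ?N * (\<integral>\<^sup>+x. epow (?s x) p \<partial>W)) (1 / p)"
    unfolding gp hp using p by (intro epow_mono) auto
  also have "\<dots> = ennreal (?N powr (1 / p)) * epow (\<integral>\<^sup>+x. epow (?s x) p \<partial>W) (1 / p)"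
    using sharp_const_pos by (simp add: epow_mult epow_ennreal)
  finally show ?thesis unfolding Lp_norm_def W_def A_def .
qed

end

text \<open>The admissible bounds are the upper bounds of one set in a complete lattice, so a least
  one exists, possibly infinite.\<close>

lemma Ap_const_eq:
  "Ap_const d k I M p w = (SUP Q\<in>inner_cubes d k I.
    avg M Q w * epow (avg M Q (\<lambda>x. epow (inverse (w x)) (1 / (p - 1)))) (p - 1))"
  unfolding Ap_const_def Ap_bound_def by (rule Least_equality) (auto intro: SUP_upper SUP_least)

lemma Ap_bound_Ap_const: "Ap_bound d k I M p w (Ap_const d k I M p w)"
  unfolding Ap_bound_def Ap_const_eq by (auto intro: SUP_upper)

lemma Ap_const_finite:
  assumes "Ap_weight d k I M p w"
  shows "Ap_const d k I M p w < \<infinity>"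
proof -
  obtain N where "N < \<infinity>" "Ap_bound d k I M p w N" using assms by (auto simp: Ap_weight_def)
  moreover from this(2) have "Ap_const d k I M p w \<le> N"
    unfolding Ap_bound_def Ap_const_eq by (auto intro: SUP_least)
  ultimately show ?thesis by (meson le_less_trans)
qed

theorem theorem7p4:
  shows "\<exists>N :: real \<Rightarrow> real \<Rightarrow> real \<Rightarrow> ennreal \<Rightarrow> real.
    \<forall>(\<gamma>::real) (p::real) (N0::real) (d::nat) (k :: nat \<Rightarrow> nat) (I :: nat \<Rightarrow> real set)
      (M :: (nat \<Rightarrow> real) measure) (w :: (nat \<Rightarrow> real) \<Rightarrow> ennreal) (f :: (nat \<Rightarrow> real) \<Rightarrow> real).
      0 < \<gamma> \<and> \<gamma> \<le> 1 \<and> 1 < p \<and> dyadic_setting d k I M N0 \<and> Ap_weight d k I M p w \<and>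
      f \<in> Lp_space p (density M w) \<longrightarrow>
      Lp_norm p (density M w) (\<lambda>x. ennreal \<bar>f x\<bar>)
        \<le> ennreal (N p N0 \<gamma> (Ap_const d k I M p w))
            * Lp_norm p (density M w) (dyadic_sharp d k I M \<gamma> f)"
proof (intro exI[of _ "\<lambda>p N0 \<gamma> A. sharp_const (max 1 N0)
      (max 1 (enn2real A * (max 1 N0) powr p) powr (1 / \<gamma>)) (p / \<gamma>) powr (1 / p)"] allI impI, elim conjE)
  fix \<gamma> p N0 :: real and d k I M w and f :: "(nat \<Rightarrow> real) \<Rightarrow> real"
  assume \<gamma>: "0 < \<gamma>" "\<gamma> \<le> 1" and p: "1 < p" and D: "dyadic_setting d k I M N0"
    and w: "Ap_weight d k I M p w" and f: "f \<in> Lp_space p (density M w)"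
  interpret dyadic_setting d k I M N0 by (rule D)
  \<comment> \<open>The real-valued constant in the witness loses nothing: for an A_p weight the
    least bound is finite, so \<open>enn2real\<close> does not fall back to its default value 0 at
    infinity.\<close>
  have "ennreal (enn2real (Ap_const d k I M p w)) = Ap_const d k I M p w"
    using Ap_const_finite[OF w] by simp
  then have "Ap_bound d k I M p w (ennreal (enn2real (Ap_const d k I M p w)))"
    by (simp only: Ap_bound_Ap_const)
  then show "Lp_norm p (density M w) (\<lambda>x. ennreal \<bar>f x\<bar>)
      \<le> ennreal (sharp_const (max 1 N0)
          (max 1 (enn2real (Ap_const d k I M p w) * (max 1 N0) powr p) powr (1 / \<gamma>)) (p / \<gamma>) powr (1 / p))
        * Lp_norm p (density M w) (dyadic_sharp d k I M \<gamma> f)"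
    using w by (intro weighted_sharp_bound[OF \<gamma> p _ _ _ f]) (auto simp: Ap_weight_def)
qed

end
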